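(* Let $G$ be a finite quiver with $n\ge1$ vertices and independent edge parameters $\beta_\varepsilon$, $\varepsilon\in E_G$. Then $$\omega_c(G)=\sum_{\mathcal B\in\operatorname{OSP}(V_G)}\frac{(-1)^{|\mathcal B|-1}}{|\mathcal B|}\prod_{\varepsilon\in E_G}\beta_{\varepsilon,s_{\mathcal B}(\varepsilon)} .$$
   Context: All quivers are finite. A quiver $G=(V_G,E_G,\rho_G)$ consists of finite sets $V_G,E_G$ and a map $\rho_G:E_G\to V_G\times V_G$; $\rho_G(\varepsilon)=(u,v)$ means $\varepsilon$ is directed from $u$ to $v$, written $\varepsilon:u\to v$. Parallel edges, directed cycles and tadpoles (edges $u\to u$) are allowed. $G$ is connected if $V_G\neq\emptyset$ and its underlying undirected graph is connected; otherwise it is called disconnected. Acyclic means without directed cycles (a tadpole is a directed cycle). Fix a field $\Bbbk$ of characteristic zero. Each edge $\varepsilon$ carries a parameter $\beta_\varepsilon$; these are independent indeterminates, and graph functions of $G$ take values in $\Bbbk[\beta_\varepsilon:\varepsilon\in E_G]$. Edges surviving in a subquiver, deletion or contraction keep their parameters. Put $\beta_{\varepsilon,\pm}=(\beta_\varepsilon\pm1)/2$. A cut-subquiver $H\preceq G$ has vertex set $V_G$ and an arbitrary edge subset $E_H\subseteq E_G$. The contraction $G/H$ has as vertices the connected components of $H$ and as edges $E_G\setminus E_H$ with induced incidences (an edge with both endpoints in one component becomes a tadpole). The function $e$: let $E_{\mathrm{tad}}(G)$ be the set of tadpoles and $G_{\mathrm{pruned}}$ the quiver obtained by deleting all tadpoles.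 For tadpole-free $G$, $e_0(G)=|\operatorname{LE}(G)|/|V_G|!$ if $G$ is acyclic ($\operatorname{LE}(G)$ = set of linear extensions of the partial order on $V_G$ induced by the edges), and $e_0(G)=0$ otherwise. In general $e(G)=\bigl(\prod_{\varepsilon\in E_{\mathrm{tad}}(G)}(-\beta_{\varepsilon,-})\bigr)e_0(G_{\mathrm{pruned}})$. The function $\omega$ is the unique function on quivers with $\sum_{H\preceq G}\omega(H)\,e(G/H)=\epsilon(G)$ for all $G$, where $\epsilon(G)=1$ if $E_G=\emptyset$ and $0$ otherwise (the convolution inverse of $e$). The connected function is $\omega_c(G)=\omega(G)$ if $G$ is connected and $\omega_c(G)=0$ otherwise. $\operatorname{OSP}(V_G)$ is the set of ordered set partitions $\mathcal B=(B_1|\cdots|B_\ell)$ of $V_G$ into nonempty disjoint blocks, $|\mathcal B|=\ell$; write $b_{\mathcal B}(v)=a$ if $v\in B_a$. For an edge $\varepsilon:j\to i$, $s_{\mathcal B}(\varepsilon)=+$ if $b_{\mathcal B}(i)<b_{\mathcal B}(j)$ and $s_{\mathcal B}(\varepsilon)=-$ if $b_{\mathcal B}(i)\ge b_{\mathcal B}(j)$ (in particular $-$ for tadpoles). Empty products are $1$. *)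

theory Defs
  imports
    "Graph_Theory.Graph_Theory"
    "HOL-Library.Poly_Mapping"
    "HOL-Library.Disjoint_Sets"
begin

text \<open>
  A finite quiver is a \<^term>\<open>fin_digraph\<close>: an arc \<open>a\<close> is directed from \<open>tail G a\<close>
  to \<open>head G a\<close>; loops, parallel arcs and the empty quiver are allowed.
\<close>

text \<open>
  The polynomial ring over \<open>'k\<close> in indeterminates indexed by the type \<open>'e\<close> of arc names.
  It contains the polynomial ring in the parameters of the arcs of any given quiver, and an arc
  keeps its parameter in subquivers, deletions and contractions because it keeps its name.
\<close>

type_synonym ('e, 'k) param_poly = "('e \<Rightarrow>\<^sub>0 nat) \<Rightarrow>\<^sub>0 'k"

definition const :: "'k \<Rightarrow> ('e, 'k::field_char_0) param_poly" where
  "const c = Poly_Mapping.single 0 c"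

definition beta :: "'e \<Rightarrow> ('e, 'k::field_char_0) param_poly" where
  "beta a = Poly_Mapping.single (Poly_Mapping.single a 1) 1"

definition beta_plus :: "'e \<Rightarrow> ('e, 'k::field_char_0) param_poly" where
  "beta_plus a = const (1 / 2) * (beta a + 1)"

definition beta_minus :: "'e \<Rightarrow> ('e, 'k::field_char_0) param_poly" where
  "beta_minus a = const (1 / 2) * (beta a - 1)"

text \<open>
  \<open>H\<close> is a cut-subquiver of \<open>G\<close> if \<^term>\<open>spanning H G\<close>. The connected components of \<open>H\<close> are
  the strong components of its underlying undirected graph \<^term>\<open>mk_symmetric H\<close>.
\<close>

definition components :: "('v, 'e) pre_digraph \<Rightarrow> 'v set set" where
  "components H = pre_digraph.sccs_verts (with_proj (mk_symmetric H))"

definition component_of :: "('v, 'e) pre_digraph \<Rightarrow> 'v \<Rightarrow> 'v set" where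
  "component_of H v = pre_digraph.scc_of (with_proj (mk_symmetric H)) v"

definition contract :: "('v, 'e) pre_digraph \<Rightarrow> ('v, 'e) pre_digraph \<Rightarrow> ('v set, 'e) pre_digraph" where
  "contract G H =
    \<lparr> verts = components H,
      arcs = arcs G - arcs H,
      tail = (\<lambda>a. component_of H (tail G a)),
      head = (\<lambda>a. component_of H (head G a)) \<rparr>"

definition tadpoles :: "('v, 'e) pre_digraph \<Rightarrow> 'e set" where
  "tadpoles G = {a \<in> arcs G. tail G a = head G a}"

definition pruned :: "('v, 'e) pre_digraph \<Rightarrow> ('v, 'e) pre_digraph" where
  "pruned G = G\<lparr> arcs := arcs G - tadpoles G \<rparr>"

definition acyclic_quiver :: "('v, 'e) pre_digraph \<Rightarrow> bool" where
  "acyclic_quiver G \<longleftrightarrow> (\<nexists>p. pre_digraph.cycle G p)"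

text \<open>
  Directed reachability is a partial order on the vertices of an acyclic quiver. Using
  the opposite partial order would give the same number of linear extensions.
\<close>

definition linear_extensions :: "('v, 'e) pre_digraph \<Rightarrow> 'v rel set" where
  "linear_extensions G =
    {L. linear_order_on (verts G) L \<and> {(u, v). u \<rightarrow>\<^sup>*\<^bsub>G\<^esub> v} \<subseteq> L}"

definition e0 :: "('v, 'e) pre_digraph \<Rightarrow> 'k::field_char_0" where
  "e0 G = (if acyclic_quiver G
    then of_nat (card (linear_extensions G)) / fact (card (verts G)) else 0)"

definition e_fun :: "('v, 'e) pre_digraph \<Rightarrow> ('e, 'k::field_char_0) param_poly" where
  "e_fun G = (\<Prod>a\<in>tadpoles G. - beta_minus a) * const (e0 (pruned G))"

definition counit :: "('v, 'e) pre_digraph \<Rightarrow> ('e, 'k::field_char_0) param_poly" where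
  "counit G = (if arcs G = {} then 1 else 0)"

text \<open>
  The second conjunct only fixes a value outside the finite quivers, so that the inverse is
  unique as a function on the whole type.
\<close>

definition is_convolution_inverse_e ::
    "(('v, 'e) pre_digraph \<Rightarrow> ('e, 'k::field_char_0) param_poly) \<Rightarrow> bool" where
  "is_convolution_inverse_e w \<longleftrightarrow>
    (\<forall>G. fin_digraph G \<longrightarrow> (\<Sum>H | spanning H G. w H * e_fun (contract G H)) = counit G) \<and>
    (\<forall>G. \<not> fin_digraph G \<longrightarrow> w G = 0)"

definition omega :: "('v, 'e) pre_digraph \<Rightarrow> ('e, 'k::field_char_0) param_poly" where
  "omega = (THE w. is_convolution_inverse_e w)"

definition omega_c :: "('v, 'e) pre_digraph \<Rightarrow> ('e, 'k::field_char_0) param_poly" where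
  "omega_c G = (if connected G then omega G else 0)"

definition OSP :: "'v set \<Rightarrow> 'v set list set" where
  "OSP V = {Bs. distinct Bs \<and> partition_on V (set Bs)}"

text \<open>Positions are counted from 0; only their order matters.\<close>

definition block_index :: "'v set list \<Rightarrow> 'v \<Rightarrow> nat" where
  "block_index Bs v = (THE i. i < length Bs \<and> v \<in> Bs ! i)"

definition beta_sign ::
    "('v, 'e) pre_digraph \<Rightarrow> 'v set list \<Rightarrow> 'e \<Rightarrow> ('e, 'k::field_char_0) param_poly" where
  "beta_sign G Bs a =
    (if block_index Bs (head G a) < block_index Bs (tail G a) then beta_plus a else beta_minus a)"

lemma spanning_fin_digraph:
  assumes "fin_digraph G" "spanning H G"
  shows "fin_digraph H"
proof -
  interpret G: fin_digraph G by fact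
  interpret H: wf_digraph H
    using assms(2) by (simp add: spanning_def subgraph_def)
  have "verts H = verts G" "arcs H \<subseteq> arcs G"
    using assms(2) by (auto simp: spanning_def subgraph_def)
  then show ?thesis
    by unfold_locales (auto intro: finite_subset)
qed

lemma spanning_arcs_inj:
  assumes "spanning H G" "spanning H' G" "arcs H = arcs H'"
  shows "H = H'"
  using assms by (auto simp: spanning_def subgraph_def compatible_def intro!: pre_digraph.equality)

lemma finite_spanning:
  assumes "fin_digraph G"
  shows "finite {H. spanning H G}"
proof (rule finite_imageD)
  have "arcs ` {H. spanning H G} \<subseteq> Pow (arcs G)"
    by (auto simp: spanning_def subgraph_def)
  then show "finite (arcs ` {H. spanning H G})"
    using fin_digraph.finite_arcs[OF assms] by (meson finite_Pow_iff finite_subset)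
  show "inj_on arcs {H. spanning H G}"
    by (auto intro: inj_onI spanning_arcs_inj)
qed

lemma spanning_self: "fin_digraph G \<Longrightarrow> spanning G G"
  by (simp add: spanning_def subgraph_def compatible_def fin_digraph_def)

lemma spanning_proper_card:
  assumes "fin_digraph G" "spanning H G" "H \<noteq> G"
  shows "card (arcs H) < card (arcs G)"
proof -
  have "arcs H \<subseteq> arcs G"
    using assms by (auto simp: spanning_def subgraph_def)
  moreover have "arcs H \<noteq> arcs G"
    using assms spanning_arcs_inj spanning_self by metis
  ultimately show ?thesis
    by (simp add: assms(1) fin_digraph.finite_arcs psubset_card_mono psubsetI)
qed

lemma finite_components:
  assumes "fin_digraph G"
  shows "finite (components G)"
proof (rule finite_subset)
  interpret fin_digraph G by fact
  show "finite (Pow (verts G))" by simp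
  show "components G \<subseteq> Pow (verts G)"
    by (auto simp: components_def pre_digraph.sccs_verts_def dest!: bspec
        elim!: reachable_in_vertsE)
qed

lemma e_fun_arcless:
  assumes "finite (verts G)" "arcs G = {}"
  shows "\<exists>c. c \<noteq> 0 \<and> e_fun G = (const c :: ('e, 'k::field_char_0) param_poly)"
proof -
  have pruned: "pruned G = G" and tad: "tadpoles G = {}"
    using assms(2) by (auto simp: pruned_def tadpoles_def)
  have acyc: "acyclic_quiver G"
    using assms(2) by (auto simp: acyclic_quiver_def pre_digraph.cycle_def pre_digraph.awalk_def)
  obtain r where r: "well_order_on (verts G) r"
    using well_order_on by blast
  then have lin: "linear_order_on (verts G) r"
    by (simp add: well_order_on_def)
  have "{(u, v). u \<rightarrow>\<^sup>*\<^bsub>G\<^esub> v} \<subseteq> Id_on (verts G)"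
  proof (clarify)
    fix u v assume "u \<rightarrow>\<^sup>*\<^bsub>G\<^esub> v"
    then show "(u, v) \<in> Id_on (verts G)"
      unfolding reachable_def
      by (induction rule: rtrancl_on_induct) (auto simp: arcs_ends_def assms(2))
  qed
  moreover have "Id_on (verts G) \<subseteq> r"
    using lin by (auto simp: order_on_defs refl_on_def)
  ultimately have "r \<in> linear_extensions G"
    using lin by (auto simp: linear_extensions_def)
  moreover have "linear_extensions G \<subseteq> Pow (verts G \<times> verts G)"
    by (auto simp: linear_extensions_def order_on_defs)
  then have "finite (linear_extensions G)"
    by (rule finite_subset) (simp add: assms(1))
  ultimately have "card (linear_extensions G) \<noteq> 0"
    by auto
  then show ?thesis
    by (intro exI[of _ "e0 G"]) (simp add: e_fun_def pruned tad acyc e0_def)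
qed

lemma e_fun_contract_self:
  assumes "fin_digraph G"
  shows "\<exists>c. c \<noteq> 0 \<and> e_fun (contract G G) = (const c :: ('e, 'k::field_char_0) param_poly)"
  by (rule e_fun_arcless) (simp_all add: contract_def finite_components assms)

lemma const_inverse: "c \<noteq> 0 \<Longrightarrow> const c * const (inverse c) = 1"
  by (simp add: const_def mult_single)

lemma convolution_split:
  assumes "fin_digraph G"
  shows "(\<Sum>H | spanning H G. w H * e_fun (contract G H)) =
    w G * e_fun (contract G G) + (\<Sum>H | spanning H G \<and> H \<noteq> G. w H * e_fun (contract G H))"
proof -
  have "{H. spanning H G} - {G} = {H. spanning H G \<and> H \<noteq> G}" by auto
  then show ?thesis
    using sum.remove[OF finite_spanning[OF assms], of G] spanning_self[OF assms] by simp
qed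

function conv_inv :: "('v, 'e) pre_digraph \<Rightarrow> ('e, 'k::field_char_0) param_poly" where
  "conv_inv G = (if fin_digraph G then
     (counit G - (\<Sum>H | spanning H G \<and> H \<noteq> G. conv_inv H * e_fun (contract G H))) *
     const (inverse (SOME c. c \<noteq> 0 \<and> e_fun (contract G G) = const c)) else 0)"
  by pat_completeness auto
termination
  by (relation "measure (\<lambda>G. card (arcs G))") (auto intro: spanning_proper_card)

declare conv_inv.simps [simp del]

lemma is_convolution_inverse_conv_inv:
  "is_convolution_inverse_e (conv_inv :: ('v, 'e) pre_digraph \<Rightarrow> ('e, 'k::field_char_0) param_poly)"
  unfolding is_convolution_inverse_e_def
proof (intro conjI allI impI)
  fix G :: "('v, 'e) pre_digraph"
  assume G: "fin_digraph G"
  define c :: 'k where "c = (SOME c. c \<noteq> 0 \<and> e_fun (contract G G) = const c)"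
  have c: "c \<noteq> 0" "e_fun (contract G G) = const c"
    using someI_ex[OF e_fun_contract_self[OF G, where 'k = 'k]] by (auto simp: c_def)
  let ?S = "\<Sum>H | spanning H G \<and> H \<noteq> G.
    conv_inv H * e_fun (contract G H) :: ('e, 'k) param_poly"
  have "conv_inv G * e_fun (contract G G) = (counit G - ?S) * (const c * const (inverse c))"
    using G by (subst conv_inv.simps, subst c(2), unfold c_def[symmetric]) (simp add: mult_ac)
  then show "(\<Sum>H | spanning H G. conv_inv H * e_fun (contract G H)) =
      (counit G :: ('e, 'k) param_poly)"
    unfolding convolution_split[OF G] const_inverse[OF c(1)] by simp
qed (simp add: conv_inv.simps)

lemma convolution_inverse_unique:
  fixes w w' :: "('v, 'e) pre_digraph \<Rightarrow> ('e, 'k::field_char_0) param_poly"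
  assumes "is_convolution_inverse_e w" "is_convolution_inverse_e w'"
  shows "w = w'"
proof
  fix G show "w G = w' G"
  proof (induction "card (arcs G)" arbitrary: G rule: less_induct)
    case less
    show ?case
    proof (cases "fin_digraph G")
      case True
      obtain c :: 'k where c: "c \<noteq> 0" "e_fun (contract G G) = const c"
        using e_fun_contract_self[OF True] by blast
      have "(\<Sum>H | spanning H G \<and> H \<noteq> G. w H * e_fun (contract G H)) =
            (\<Sum>H | spanning H G \<and> H \<noteq> G. w' H * e_fun (contract G H))"
        by (intro sum.cong refl) (auto simp: less spanning_proper_card[OF True])
      moreover have "(\<Sum>H | spanning H G. w H * e_fun (contract G H)) =
                     (\<Sum>H | spanning H G. w' H * e_fun (contract G H))"
        using assms True by (simp add: is_convolution_inverse_e_def)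
      ultimately have "w G * const c = w' G * const c"
        by (simp add: convolution_split[OF True] c(2))
      then have "w G * (const c * const (inverse c)) = w' G * (const c * const (inverse c))"
        by (simp add: mult.assoc[symmetric])
      then show ?thesis
        by (simp add: const_inverse[OF c(1)])
    next
      case False
      then show ?thesis using assms by (simp add: is_convolution_inverse_e_def)
    qed
  qed
qed

theorem ex1_convolution_inverse: "\<exists>!w. is_convolution_inverse_e w"
  using is_convolution_inverse_conv_inv convolution_inverse_unique by blast

lemma is_convolution_inverse_omega: "is_convolution_inverse_e omega"
  unfolding omega_def by (rule theI'[OF ex1_convolution_inverse])

end

theory Submission
  imports Defs "HOL-Computational_Algebra.Formal_Power_Series"
begin

text \<open>
  By uniqueness of the convolution inverse it suffices to find a function \<open>w\<close> that inverts
  \<open>e\<close> and agrees with the asserted sum on connected quivers, and to show that the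
  sum is \<open>0\<close> on disconnected quivers with at least one vertex. The function is
  \<open>component_product\<close>, the product of the sums over the connected components.

  For a set \<open>V\<close> of vertices let \<open>L(V)\<close> be the sum of \<open>(-1)\<^sup>\<ell>\<^sup>-\<^sup>1 / \<ell>\<close> over the ordered set
  partitions of \<open>V\<close> into \<open>\<ell>\<close> blocks for which all arcs inside \<open>V\<close> have sign \<open>+\<close>
  (\<open>log_count\<close>). As \<open>\<beta>\<^sub>+ - \<beta>\<^sub>- = 1\<close>, the sum for a quiver is a combination of the
  values \<open>L(V)\<close> of its cut-subquivers (\<open>osp_sum_expand\<close>), and summing it over all
  cut-subquivers with weight \<open>-\<beta>\<^sub>-\<close> for each missing arc leaves just \<open>L(V)\<close>
  (\<open>osp_sum_convolution\<close>). In the convolution of \<open>w\<close> with \<open>e\<close> these missing arcs inside a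
  component are the tadpoles of the contraction. Hence the convolution equals
  \<open>\<Sum>\<^sub>\<pi> e\<^sub>0(G/\<pi>) \<Prod>\<^sub>B L(B)\<close>, where \<open>\<pi>\<close> runs over all set partitions of the vertices,
  \<open>B\<close> over the blocks of \<open>\<pi>\<close>, and tadpoles of \<open>G/\<pi>\<close> are ignored; here one needs that
  the sum for a disconnected quiver vanishes because its \<open>L\<close> does, so that for given \<open>\<pi>\<close> all
  choices of arcs inside the blocks may be included, not only those that connect every block.

  Two facts about \<open>L\<close> remain. Writing \<open>e\<^sub>0(G/\<pi>)\<close> as the proportion of orderings of \<open>\<pi>\<close>
  compatible with the arcs turns the last sum into one over ordered set partitions with
  coefficients \<open>1/k!\<close>, whose blocks are then partitioned further with coefficients
  \<open>(-1)\<^sup>\<ell>\<^sup>-\<^sup>1 / \<ell>\<close>. Concatenating the inner partitions gives a single ordered partition with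
  blocks grouped into consecutive runs, and \<open>exp (ln (1 + X)) = 1 + X\<close> shows that
  everything cancels except partitions with at most one block; the sum is \<open>1\<close> if there are no
  arcs and \<open>0\<close> otherwise (\<open>sum_descending_log_count\<close>). The vanishing of \<open>L\<close> on
  disconnected sets (\<open>log_count_split\<close>) follows from this identity by induction, since
  ordered partitions subordinate to a splitting \<open>V = A \<union> B\<close> are shuffles of ordered partitions
  of \<open>A\<close> and \<open>B\<close>.
\<close>

section \<open>Ordered set partitions\<close>

lemma OSP_iff:
  "Bs \<in> OSP V \<longleftrightarrow> \<Union>(set Bs) = V \<and> {} \<notin> set Bs \<and> sorted_wrt (\<lambda>B C. B \<inter> C = {}) Bs"
proof -
  have "distinct Bs \<and> disjoint (set Bs) \<longleftrightarrow> sorted_wrt (\<lambda>B C. B \<inter> C = {}) Bs"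
    if "{} \<notin> set Bs"
    using that
    by (induction Bs) (auto simp: pairwise_insert disjnt_def)
  then show ?thesis
    by (auto simp: OSP_def partition_on_def)
qed

lemma finite_OSP: "finite V \<Longrightarrow> finite (OSP V)"
  by (rule finite_subset[OF _ finite_subset_distinct[of "Pow V"]])
    (auto simp: OSP_def partition_on_def)

lemma OSP_block_V:
  assumes "Bs \<in> OSP V" "V \<in> set Bs"
  shows "Bs = [V]"
proof -
  have "B = V" if "B \<in> set Bs" for B
  proof (rule ccontr)
    assume "B \<noteq> V"
    then have "B \<inter> V = {}"
      using assms that unfolding OSP_def partition_on_def by (blast dest: disjointD)
    moreover have "B \<subseteq> V" "B \<noteq> {}"
      using assms(1) that by (auto simp: OSP_def partition_on_def)
    ultimately show False by blast
  qed
  then have "set Bs = {V}" using assms(2) by blast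
  moreover from this have "length Bs = 1"
    using assms(1) distinct_card[of Bs] by (simp add: OSP_def)
  ultimately show ?thesis
    by (auto simp: length_Suc_conv)
qed

lemma sorted_wrt_concat:
  "sorted_wrt P (concat xss) \<longleftrightarrow>
    (\<forall>xs\<in>set xss. sorted_wrt P xs) \<and> sorted_wrt (\<lambda>xs ys. \<forall>x\<in>set xs. \<forall>y\<in>set ys. P x y) xss"
  by (induction xss) (auto simp: sorted_wrt_append)

text \<open>
  A relation \<open>r\<close> on vertices stands for a set of arcs, \<open>(u, v) \<in> r\<close> meaning an arc from \<open>u\<close> to
  \<open>v\<close>. The list is descending if an arc between two different blocks always leads to the earlier
  one, and strictly descending if moreover no arc stays inside a block; the latter means that
  every arc has sign \<open>+\<close>. Arcs that leave the union of the blocks are ignored, so the same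
  \<open>r\<close> serves for all induced subquivers.
\<close>

definition descending :: "('v \<times> 'v) set \<Rightarrow> 'v set list \<Rightarrow> bool" where
  "descending r Bs \<longleftrightarrow> sorted_wrt (\<lambda>B C. r \<inter> B \<times> C = {}) Bs"

definition strictly_descending :: "('v \<times> 'v) set \<Rightarrow> 'v set list \<Rightarrow> bool" where
  "strictly_descending r Bs \<longleftrightarrow> descending r Bs \<and> (\<forall>B\<in>set Bs. r \<inter> B \<times> B = {})"

text \<open>
  If \<open>P\<close> denotes the strict order polynomial of the subquiver induced on \<open>V\<close>, that is
  \<open>P(N) = \<Sum>\<^sub>B\<^sub>s (N choose length Bs)\<close> over the strictly descending \<open>Bs\<close>, then this is the linear
  coefficient of \<open>P\<close>, because \<open>(-1)\<^sup>\<ell>\<^sup>-\<^sup>1 / \<ell>\<close> is the linear coefficient of \<open>N choose \<ell>\<close>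
  for \<open>\<ell> \<ge> 1\<close>.
\<close>

definition log_count :: "('v \<times> 'v) set \<Rightarrow> 'v set \<Rightarrow> 'k::field_char_0" where
  "log_count r V = (\<Sum>Bs | Bs \<in> OSP V \<and> strictly_descending r Bs. (-1) ^ (length Bs - 1) / of_nat (length Bs))"

section \<open>Exponentiating a logarithm over groupings of a list\<close>

unbundle fps_syntax

text \<open>The coefficients of \<open>exp (ln (1 + X)) = 1 + X\<close>.\<close>

lemma exp_log_coeff:
  "(\<Sum>k\<le>n. (fps_ln 1 ^ k) $ n / fact k :: 'k::field_char_0) = (if n \<le> 1 then 1 else 0)"
proof -
  have "(fps_exp 1 - 1) oo fps_ln 1 = (fps_X :: 'k fps)"
    by (simp add: fps_ln_fps_exp_inv fps_inv_right)
  then have "fps_exp 1 oo fps_ln 1 = (1 + fps_X :: 'k fps)"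
    by (simp add: fps_compose_sub_distrib algebra_simps)
  then have "(fps_exp 1 oo fps_ln 1) $ n = (1 + fps_X :: 'k fps) $ n"
    by simp
  then show ?thesis
    by (simp add: fps_compose_nth atLeast0AtMost fps_X_def le_Suc_eq split: if_splits)
qed

text \<open>The ways of cutting a list into \<open>k\<close> nonempty consecutive pieces.\<close>

definition groupings :: "nat \<Rightarrow> 'a list \<Rightarrow> 'a list list set" where
  "groupings k xs = {xss. concat xss = xs \<and> [] \<notin> set xss \<and> length xss = k}"

lemma groupings_Suc:
  "bij_betw (\<lambda>(i, xss). take i xs # xss)
    (SIGMA i:{1..length xs}. groupings k (drop i xs)) (groupings (Suc k) xs)"
proof (rule bij_betw_byWitness[where f' = "\<lambda>xss. (length (hd xss), tl xss)"])
  show "\<forall>xss\<in>groupings (Suc k) xs. (\<lambda>(i, xss). take i xs # xss) (length (hd xss), tl xss) = xss"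
    by (auto simp: groupings_def length_Suc_conv)
qed (auto simp: groupings_def length_Suc_conv Suc_le_eq)

lemma finite_groupings: "finite (groupings k xs)"
proof (induction k arbitrary: xs)
  case 0
  show ?case by (rule finite_subset[of _ "{[]}"]) (auto simp: groupings_def)
next
  case (Suc k)
  then show ?case
    using bij_betw_finite[OF groupings_Suc[of xs k]] by auto
qed

text \<open>
  The \<open>k\<close>-th power of a series without constant term enumerates the cuts of a list of length
  \<open>n\<close> into \<open>k\<close> nonempty pieces, each piece weighted by the coefficient at its length.
\<close>

lemma sum_groupings:
  fixes a :: "'k::comm_ring_1 fps"
  assumes "a $ 0 = 0"
  shows "(\<Sum>xss\<in>groupings k xs. prod_list (map (\<lambda>ys. a $ length ys) xss)) = (a ^ k) $ length xs"
proof (induction k arbitrary: xs)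
  case 0
  have "groupings 0 xs = (if xs = [] then {[]} else {})"
    by (auto simp: groupings_def)
  then show ?case by auto
next
  case (Suc k)
  have "(\<Sum>xss\<in>groupings (Suc k) xs. prod_list (map (\<lambda>ys. a $ length ys) xss)) =
      (\<Sum>(i, xss)\<in>(SIGMA i:{1..length xs}. groupings k (drop i xs)).
        a $ i * prod_list (map (\<lambda>ys. a $ length ys) xss))"
    by (subst sum.reindex_bij_betw[OF groupings_Suc, symmetric])
      (rule sum.cong, auto simp: min_def)
  also have "\<dots> = (\<Sum>i=1..length xs. a $ i * (a ^ k) $ (length xs - i))"
    by (subst sum.Sigma[symmetric]) (auto simp: finite_groupings sum_distrib_left[symmetric] Suc)
  also have "\<dots> = (\<Sum>i=0..length xs. a $ i * (a ^ k) $ (length xs - i))"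
    by (rule sum.mono_neutral_left) (auto simp: assms not_less_eq_eq)
  finally show ?case
    by (simp add: fps_mult_nth)
qed

lemma length_le_concat: "[] \<notin> set xss \<Longrightarrow> length xss \<le> length (concat xss)"
proof (induction xss)
  case (Cons xs xss)
  then show ?case by (cases xs) auto
qed simp

lemma UN_groupings: "{xss. [] \<notin> set xss \<and> concat xss = xs} = (\<Union>k\<le>length xs. groupings k xs)"
  using length_le_concat by (auto simp: groupings_def)

lemma sum_exp_log_groupings:
  "(\<Sum>xss | [] \<notin> set xss \<and> concat xss = xs.
      prod_list (map (\<lambda>ys. (-1) ^ (length ys - 1) / of_nat (length ys)) xss) / fact (length xss)) =
    (if length xs \<le> 1 then 1 else 0 :: 'k::field_char_0)" (is "(\<Sum>xss | _. ?w xss) = _")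
proof -
  have ln: "fps_ln 1 $ n = ((-1) ^ (n - 1) / of_nat n :: 'k)" for n
    by (simp add: fps_ln_nth)
  have "(\<Sum>xss | [] \<notin> set xss \<and> concat xss = xs. ?w xss) =
      (\<Sum>k\<le>length xs. \<Sum>xss\<in>groupings k xs. ?w xss)"
    unfolding UN_groupings
    by (rule sum.UNION_disjoint) (simp_all add: finite_groupings, auto simp: groupings_def)
  also have "\<dots> = (\<Sum>k\<le>length xs. (fps_ln 1 ^ k) $ length xs / fact k)"
  proof (rule sum.cong[OF refl])
    fix k
    have "(\<Sum>xss\<in>groupings k xs. ?w xss) =
        (\<Sum>xss\<in>groupings k xs. prod_list (map (\<lambda>ys. fps_ln 1 $ length ys) xss) / fact k)"
      by (rule sum.cong) (auto simp: groupings_def ln)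
    also have "\<dots> = (fps_ln 1 ^ k) $ length xs / fact k"
      by (simp add: sum_divide_distrib[symmetric] sum_groupings)
    finally show "(\<Sum>xss\<in>groupings k xs. ?w xss) = (fps_ln 1 ^ k) $ length xs / fact k" .
  qed
  finally show ?thesis by (simp only: exp_log_coeff)
qed

lemma in_listset: "xs \<in> listset As \<longleftrightarrow> list_all2 (\<in>) xs As"
  by (induction As arbitrary: xs) (auto simp: set_Cons_def list_all2_Cons2)

lemma sum_listset:
  fixes f :: "'a \<Rightarrow> 'k::comm_semiring_1"
  assumes "\<forall>A\<in>set As. finite A"
  shows "(\<Sum>xs\<in>listset As. prod_list (map f xs)) = prod_list (map (sum f) As)"
  using assms
proof (induction As)
  case (Cons A As)
  have eq: "listset (A # As) = (\<lambda>(x, xs). x # xs) ` (A \<times> listset As)"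
    by (auto simp: set_Cons_def)
  have "(\<Sum>xs\<in>listset (A # As). prod_list (map f xs)) =
      (\<Sum>(x, xs)\<in>A \<times> listset As. f x * prod_list (map f xs))"
    unfolding eq by (subst sum.reindex) (auto simp: inj_on_def intro!: sum.cong)
  also have "\<dots> = sum f A * (\<Sum>xs\<in>listset As. prod_list (map f xs))"
    by (simp add: sum.cartesian_product[symmetric] sum_product)
  finally show ?case using Cons by simp
qed simp

section \<open>The exponential formula for strictly descending partitions\<close>

text \<open>
  Strictly descending partitions with their blocks grouped into nonempty consecutive pieces
  are the same as a descending partition \<open>Bs\<close> (the unions of the pieces) together with a
  strictly descending partition of every block of \<open>Bs\<close>.
\<close>

lemma refinement_fibre:
  assumes "Bs \<in> OSP V" "descending r Bs"
  shows "{css. [] \<notin> set css \<and> concat css \<in> OSP V \<and> strictly_descending r (concat css)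
      \<and> map (\<lambda>cs. \<Union>(set cs)) css = Bs} =
    listset (map (\<lambda>B. {Cs \<in> OSP B. strictly_descending r Cs}) Bs)" (is "?L = ?R")
proof (intro set_eqI iffI)
  fix css
  assume "css \<in> ?L"
  then have Bs: "Bs = map (\<lambda>cs. \<Union>(set cs)) css"
    and c: "[] \<notin> set css" "{} \<notin> set (concat css)" "sorted_wrt (\<lambda>B C. B \<inter> C = {}) (concat css)"
      "sorted_wrt (\<lambda>B C. r \<inter> B \<times> C = {}) (concat css)" "\<forall>B\<in>set (concat css). r \<inter> B \<times> B = {}"
    by (auto simp: OSP_iff strictly_descending_def descending_def)
  from c(2-5) show "css \<in> ?R"
    unfolding Bs sorted_wrt_concat
    by (auto simp: in_listset list_all2_map2 list_all2_same OSP_iff strictly_descending_def descending_def)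
next
  fix css
  assume "css \<in> ?R"
  then have all: "list_all2 (\<lambda>cs B. cs \<in> OSP B \<and> strictly_descending r cs) css Bs"
    by (simp add: in_listset list_all2_map2)
  then have "list_all2 (\<lambda>cs B. B = \<Union>(set cs)) css Bs"
    by (rule list_all2_mono) (auto simp: OSP_iff)
  then have Bs: "Bs = map (\<lambda>cs. \<Union>(set cs)) css"
    by (induction) auto
  have cs: "\<forall>cs\<in>set css. cs \<in> OSP (\<Union>(set cs)) \<and> strictly_descending r cs"
    using all unfolding Bs by (auto simp: list_all2_map2 list_all2_same)
  have "sorted_wrt (\<lambda>B C. B \<inter> C = {}) Bs" "sorted_wrt (\<lambda>B C. r \<inter> B \<times> C = {}) Bs" "{} \<notin> set Bs"
      "\<Union>(set Bs) = V"
    using assms by (auto simp: OSP_iff descending_def)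
  then have U: "sorted_wrt (\<lambda>cs ds. \<Union>(set cs) \<inter> \<Union>(set ds) = {}) css"
    "sorted_wrt (\<lambda>cs ds. r \<inter> \<Union>(set cs) \<times> \<Union>(set ds) = {}) css"
    "{} \<notin> (\<lambda>cs. \<Union>(set cs)) ` set css" "(\<Union>cs\<in>set css. \<Union>(set cs)) = V"
    unfolding Bs by (auto simp: sorted_wrt_map)
  have d: "sorted_wrt (\<lambda>cs ds. \<forall>B\<in>set cs. \<forall>C\<in>set ds. B \<inter> C = {}) css"
    by (rule sorted_wrt_mono_rel[OF _ U(1)]) blast
  have e: "sorted_wrt (\<lambda>cs ds. \<forall>B\<in>set cs. \<forall>C\<in>set ds. r \<inter> B \<times> C = {}) css"
    by (rule sorted_wrt_mono_rel[OF _ U(2)]) blast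
  have "[] \<notin> set css" using U(3) by force
  show "css \<in> ?L"
    using cs d e \<open>[] \<notin> set css\<close> U(4) Bs
    by (auto simp: OSP_iff strictly_descending_def descending_def sorted_wrt_concat)
qed

text \<open>
  Expanding each \<^const>\<open>log_count\<close> gives a sum over grouped strictly descending partitions
  \<open>css\<close>. For fixed \<open>concat css\<close> of length \<open>\<ell>\<close> the sum over the groupings is the coefficient of
  \<open>X\<^sup>\<ell>\<close> in \<open>1 + X\<close>, so only partitions with at most one block survive. This is the empty
  list if \<open>V\<close> is empty and otherwise \<open>[V]\<close>, which is strictly descending exactly if no arc lies
  inside \<open>V\<close>.
\<close>

lemma sum_descending_log_count:
  fixes V :: "'v set"
  assumes "finite V"
  shows "(\<Sum>Bs | Bs \<in> OSP V \<and> descending r Bs. (\<Prod>B\<in>set Bs. log_count r B) / fact (length Bs)) =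
    (if r \<inter> V \<times> V = {} then 1 else 0 :: 'k::field_char_0)"
proof -
  define T where "T = {css. [] \<notin> set css \<and> concat css \<in> OSP V \<and> strictly_descending r (concat css)}"
  define S where "S = {Cs \<in> OSP V. strictly_descending r Cs}"
  define D where "D = {Bs \<in> OSP V. descending r Bs}"
  define w :: "'v set list list \<Rightarrow> 'k" where
    "w css = prod_list (map (\<lambda>cs. (-1) ^ (length cs - 1) / of_nat (length cs)) css) / fact (length css)" for css
  have fin: "finite S" "finite D"
    using finite_OSP[OF assms] by (simp_all add: S_def D_def)
  have "T = (\<Union>Cs\<in>S. {css. [] \<notin> set css \<and> concat css = Cs})"
    by (auto simp: T_def S_def)
  then have "finite T"
    using fin by (simp add: UN_groupings finite_groupings)
  have "(\<Sum>Bs\<in>D. (\<Prod>B\<in>set Bs. log_count r B) / fact (length Bs)) =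
      (\<Sum>Bs\<in>D. \<Sum>css | css \<in> T \<and> map (\<lambda>cs. \<Union>(set cs)) css = Bs. w css)"
  proof (rule sum.cong[OF refl])
    fix Bs assume "Bs \<in> D"
    then have Bs: "Bs \<in> OSP V" "descending r Bs" by (auto simp: D_def)
    have finB: "\<forall>B\<in>set Bs. finite B"
      using Bs(1) assms by (auto simp: OSP_iff intro: finite_subset)
    have "{css. css \<in> T \<and> map (\<lambda>cs. \<Union>(set cs)) css = Bs} =
        listset (map (\<lambda>B. {Cs \<in> OSP B. strictly_descending r Cs}) Bs)" (is "?F = listset ?As")
      using refinement_fibre[OF Bs] by (auto simp: T_def)
    moreover have "length css = length Bs" if "css \<in> ?F" for css
      using that by auto
    ultimately have "(\<Sum>css\<in>?F. w css) =
        (\<Sum>css\<in>listset ?As. prod_list (map (\<lambda>cs. (-1) ^ (length cs - 1) / of_nat (length cs)) css)) / fact (length Bs)"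
      unfolding sum_divide_distrib by (intro sum.cong) (auto simp: w_def)
    also have "\<dots> = prod_list (map (log_count r) Bs) / fact (length Bs)"
      by (subst sum_listset) (auto simp: finB finite_OSP log_count_def[abs_def] comp_def)
    also have "prod_list (map (log_count r) Bs) = (\<Prod>B\<in>set Bs. log_count r B :: 'k)"
      using Bs(1) by (intro prod.distinct_set_conv_list[symmetric]) (simp add: OSP_def)
    finally show "(\<Prod>B\<in>set Bs. log_count r B) / fact (length Bs) = (\<Sum>css\<in>?F. w css)" by simp
  qed
  also have "\<dots> = sum w T"
  proof (rule sum.group[OF \<open>finite T\<close> fin(2)], safe)
    fix css assume "css \<in> T"
    then have css: "[] \<notin> set css" "{} \<notin> set (concat css)"
      "sorted_wrt (\<lambda>cs ds. \<forall>B\<in>set cs. \<forall>C\<in>set ds. B \<inter> C = {}) css"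
      "sorted_wrt (\<lambda>cs ds. \<forall>B\<in>set cs. \<forall>C\<in>set ds. r \<inter> B \<times> C = {}) css"
      by (simp_all add: T_def OSP_iff strictly_descending_def descending_def sorted_wrt_concat)
    have "\<Union>(set cs) \<noteq> {}" if "cs \<in> set css" for cs
      using css(1,2) that by (cases cs) auto
    then have "{} \<notin> set (map (\<lambda>cs. \<Union>(set cs)) css)"
      by force
    moreover have "sorted_wrt (\<lambda>cs ds. \<Union>(set cs) \<inter> \<Union>(set ds) = {}) css"
      by (rule sorted_wrt_mono_rel[OF _ css(3)]) blast
    moreover have "sorted_wrt (\<lambda>cs ds. r \<inter> \<Union>(set cs) \<times> \<Union>(set ds) = {}) css"
      by (rule sorted_wrt_mono_rel[OF _ css(4)]) blast
    moreover have "\<Union>(set (map (\<lambda>cs. \<Union>(set cs)) css)) = V"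
      using \<open>css \<in> T\<close> by (auto simp: T_def OSP_iff)
    ultimately show "map (\<lambda>cs. \<Union>(set cs)) css \<in> D"
      by (simp add: D_def OSP_iff descending_def sorted_wrt_map)
  qed
  also have "\<dots> = (\<Sum>Cs\<in>S. \<Sum>css | css \<in> T \<and> concat css = Cs. w css)"
    by (rule sum.group[symmetric]) (use \<open>finite T\<close> fin in \<open>auto simp: T_def S_def\<close>)
  also have "\<dots> = (\<Sum>Cs\<in>S. if length Cs \<le> 1 then 1 else 0)"
  proof (rule sum.cong[OF refl])
    fix Cs assume "Cs \<in> S"
    then have "{css. css \<in> T \<and> concat css = Cs} = {css. [] \<notin> set css \<and> concat css = Cs}"
      by (auto simp: T_def S_def)
    then show "(\<Sum>css | css \<in> T \<and> concat css = Cs. w css) = (if length Cs \<le> 1 then 1 else 0)"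
      unfolding w_def by (simp only: sum_exp_log_groupings)
  qed
  also have "\<dots> = of_nat (card {Cs \<in> S. length Cs \<le> 1})"
    using fin by (simp add: sum.If_cases Int_def)
  also have "{Cs \<in> S. length Cs \<le> 1} =
      (if r \<inter> V \<times> V = {} then {if V = {} then [] else [V]} else {})"
    by (auto simp: S_def OSP_iff strictly_descending_def descending_def le_Suc_eq length_Suc_conv)
  also have "of_nat (card \<dots>) = (if r \<inter> V \<times> V = {} then 1 else 0 :: 'k)"
    by simp
  finally show ?thesis by (simp add: D_def)
qed

section \<open>Vanishing on disconnected vertex sets\<close>

lemma sorted_wrt_partition:
  assumes "sorted_wrt P (filter Q xs)" "sorted_wrt P (filter (\<lambda>x. \<not> Q x) xs)"
    and "\<And>x y. x \<in> set xs \<Longrightarrow> y \<in> set xs \<Longrightarrow> Q x \<noteq> Q y \<Longrightarrow> P x y"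
  shows "sorted_wrt P xs"
  using assms
proof (induction xs)
  case (Cons x xs)
  then show ?case by (cases "Q x") auto
qed simp

text \<open>
  Induction on the size of \<open>V\<close>. In the exponential formula for \<open>V\<close>, a block that meets both
  \<open>A\<close> and \<open>B\<close> contributes \<open>0\<close> by the induction hypothesis, unless it is \<open>V\<close> itself.
  The remaining partitions are the shuffles of a partition of \<open>A\<close> with one of \<open>B\<close>;
  the number of shuffles turns their sum into the product of the formulas for \<open>A\<close> and \<open>B\<close>.
  This product already accounts for the value of the formula for \<open>V\<close>, which leaves \<open>0\<close> for
  the term of \<open>[V]\<close>.
\<close>

lemma log_count_split:
  fixes V :: "'v set"
  assumes "finite V" "V = A \<union> B" "A \<inter> B = {}" "A \<noteq> {}" "B \<noteq> {}"
    and "r \<inter> A \<times> B = {}" "r \<inter> B \<times> A = {}"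
  shows "log_count r V = (0 :: 'k::field_char_0)"
  using assms
proof (induction "card V" arbitrary: V A B rule: less_induct)
  case less
  define g :: "'v set list \<Rightarrow> 'k" where "g Bs = (\<Prod>B\<in>set Bs. log_count r B) / fact (length Bs)" for Bs
  define D where "D W = {Bs \<in> OSP W. descending r Bs}" for W
  have g: "sum g (D W) = (if r \<inter> W \<times> W = {} then 1 else 0)" if "finite W" for W
    using sum_descending_log_count[OF that, of r, where 'k = 'k] by (simp add: g_def D_def)
  have fin: "finite V" "finite A" "finite B" using less.prems by auto
  have finD: "finite (D W)" if "finite W" for W
    using finite_OSP[OF that] by (simp add: D_def)
  \<comment> \<open>the partitions none of whose blocks meets both sides\<close>
  define X where "X = {Bs \<in> D V. \<forall>C\<in>set Bs. C \<subseteq> A \<or> C \<subseteq> B}"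
  have V: "[V] \<in> D V" "[V] \<notin> X"
    using less.prems by (auto simp: D_def X_def OSP_iff descending_def)
  have "sum g (D V) = sum g (insert [V] X)"
  proof (rule sum.mono_neutral_right[OF finD[OF fin(1)]])
    show "insert [V] X \<subseteq> D V" using V by (auto simp: X_def)
    show "\<forall>Bs\<in>D V - insert [V] X. g Bs = 0"
    proof
      fix Bs assume Bs: "Bs \<in> D V - insert [V] X"
      then obtain C where C: "C \<in> set Bs" "\<not> C \<subseteq> A" "\<not> C \<subseteq> B"
        by (auto simp: X_def)
      have "C \<subseteq> V" using Bs C(1) by (auto simp: D_def OSP_iff)
      moreover have "C \<noteq> V" using Bs C(1) OSP_block_V by (auto simp: D_def)
      ultimately have "C \<subset> V" by auto
      have "log_count r C = (0 :: 'k)"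
      proof (rule less.hyps)
        show "card C < card V" using \<open>C \<subset> V\<close> fin by (simp add: psubset_card_mono)
        show "C = (C \<inter> A) \<union> (C \<inter> B)" "finite C"
          using \<open>C \<subseteq> V\<close> less.prems(2) fin(1) by (auto intro: finite_subset)
      qed (use C \<open>C \<subseteq> V\<close> less.prems in auto)
      then show "g Bs = 0" using C(1) by (auto simp: g_def)
    qed
  qed
  also have "\<dots> = g [V] + sum g X"
    using V finD[OF fin(1)] by (subst sum.insert) (auto simp: X_def)
  also have "g [V] = log_count r V" by (simp add: g_def)
  also have "sum g X = sum g (D A) * sum g (D B)"
  proof -
    define Q where "Q = (\<lambda>C. C \<subseteq> A)"
    have Q: "C \<subseteq> A" if "C \<in> set Bs" "Q C" for C Bs using that by (auto simp: Q_def)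
    have Q': "C \<subseteq> B" if "Bs \<in> X" "C \<in> set Bs" "\<not> Q C" for C Bs
      using that by (auto simp: X_def Q_def)
    have "sum g X = (\<Sum>pq\<in>D A \<times> D B. \<Sum>Bs | Bs \<in> X \<and> partition Q Bs = pq. g Bs)"
    proof (rule sum.group[symmetric])
      show "finite X" "finite (D A \<times> D B)" using finD fin by (auto simp: X_def)
      have "filter Q Bs \<in> D A \<and> filter (\<lambda>C. \<not> Q C) Bs \<in> D B" if "Bs \<in> X" for Bs
      proof -
        have Bs: "\<Union>(set Bs) = V" "{} \<notin> set Bs" "sorted_wrt (\<lambda>B C. B \<inter> C = {}) Bs"
            "sorted_wrt (\<lambda>B C. r \<inter> B \<times> C = {}) Bs" "\<And>C. C \<in> set Bs \<Longrightarrow> C \<subseteq> A \<or> C \<subseteq> B"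
          using that by (auto simp: X_def D_def OSP_iff descending_def)
        have U: "\<Union>(set (filter Q Bs)) = A" "\<Union>(set (filter (\<lambda>C. \<not> Q C) Bs)) = B"
        proof -
          have le: "\<Union>(set (filter Q Bs)) \<subseteq> A" "\<Union>(set (filter (\<lambda>C. \<not> Q C) Bs)) \<subseteq> B"
            using Bs(5) by (auto simp: Q_def)
          have "\<Union>(set (filter Q Bs)) \<union> \<Union>(set (filter (\<lambda>C. \<not> Q C) Bs)) = A \<union> B"
            using Bs(1) less.prems(2) by auto
          with le less.prems(3) show "\<Union>(set (filter Q Bs)) = A" "\<Union>(set (filter (\<lambda>C. \<not> Q C) Bs)) = B"
            by blast+
        qed
        then show ?thesis
          unfolding D_def OSP_iff descending_def mem_Collect_eq U
          using Bs(2-4) by (simp add: sorted_wrt_filter)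
      qed
      then show "partition Q ` X \<subseteq> D A \<times> D B" by (auto simp: comp_def)
    qed
    also have "\<dots> = (\<Sum>(p, q)\<in>D A \<times> D B. g p * g q)"
    proof (rule sum.cong[OF refl], clarify)
      fix p q assume p: "p \<in> D A" and q: "q \<in> D B"
      have sub: "C \<subseteq> A" "C \<noteq> {}" if "C \<in> set p" for C using that p by (auto simp: D_def OSP_iff)
      have sub': "C \<subseteq> B" "C \<noteq> {}" if "C \<in> set q" for C using that q by (auto simp: D_def OSP_iff)
      have Qp: "\<forall>C\<in>set p. Q C" using sub by (auto simp: Q_def)
      have Qq: "\<forall>C\<in>set q. \<not> Q C" using sub' less.prems(3) unfolding Q_def by blast
      have disj: "set p \<inter> set q = {}" using Qp Qq by auto
      have img: "partition Q -` {(p, q)} = shuffles p q"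
        by (rule inv_image_partition) (use Qp Qq in auto)
      have "Bs \<in> X" if "Bs \<in> shuffles p q" for Bs
      proof -
        have f: "filter Q Bs = p" "filter (\<lambda>C. \<not> Q C) Bs = q"
          using img that by (auto simp: comp_def)
        have s: "set Bs = set p \<union> set q" using that by (rule set_shuffles)
        have "sorted_wrt (\<lambda>B C. B \<inter> C = {}) Bs"
        proof (rule sorted_wrt_partition[where Q = Q])
          fix x y assume xy: "x \<in> set Bs" "y \<in> set Bs" "Q x \<noteq> Q y"
          then have "x \<subseteq> A \<and> y \<subseteq> B \<or> x \<subseteq> B \<and> y \<subseteq> A"
            using s Qp Qq sub sub' by blast
          then show "x \<inter> y = {}" using less.prems(3) by blast
        qed (use f p q in \<open>auto simp: D_def OSP_iff\<close>)
        moreover have "sorted_wrt (\<lambda>B C. r \<inter> B \<times> C = {}) Bs"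
        proof (rule sorted_wrt_partition[where Q = Q])
          fix x y assume xy: "x \<in> set Bs" "y \<in> set Bs" "Q x \<noteq> Q y"
          then have "x \<subseteq> A \<and> y \<subseteq> B \<or> x \<subseteq> B \<and> y \<subseteq> A"
            using s Qp Qq sub sub' by blast
          then show "r \<inter> x \<times> y = {}" using less.prems(6,7) by blast
        qed (use f p q in \<open>auto simp: D_def descending_def\<close>)
        moreover have "\<Union>(set Bs) = V" "{} \<notin> set Bs"
          using p q s less.prems(2) by (simp_all add: D_def OSP_iff)
        moreover have "\<forall>C\<in>set Bs. C \<subseteq> A \<or> C \<subseteq> B"
          using s sub(1) sub'(1) by blast
        ultimately show ?thesis
          by (simp add: X_def D_def OSP_iff descending_def)
      qed
      then have "{Bs. Bs \<in> X \<and> partition Q Bs = (p, q)} = shuffles p q"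
        using img by auto
      then have "(\<Sum>Bs | Bs \<in> X \<and> partition Q Bs = (p, q). g Bs) =
          (\<Sum>Bs\<in>shuffles p q. (\<Prod>C\<in>set p \<union> set q. log_count r C) / fact (length p + length q))"
        by (intro sum.cong) (auto simp: g_def set_shuffles length_shuffles)
      also have "\<dots> = of_nat ((length p + length q) choose length p) *
          ((\<Prod>C\<in>set p. log_count r C) * (\<Prod>C\<in>set q. log_count r C)) / fact (length p + length q)"
        by (simp add: card_disjoint_shuffles[OF disj] prod.union_disjoint disj)
      also have "\<dots> = g p * g q"
        by (simp add: g_def binomial_fact)
      finally show "(\<Sum>Bs | Bs \<in> X \<and> partition Q Bs = (p, q). g Bs) = g p * g q" .
    qed
    also have "\<dots> = sum g (D A) * sum g (D B)"
      by (simp add: sum.cartesian_product[symmetric] sum_product)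
    finally show ?thesis .
  qed
  finally have "log_count r V = sum g (D V) - sum g (D A) * sum g (D B)" by simp
  moreover have "r \<inter> V \<times> V = {} \<longleftrightarrow> r \<inter> A \<times> A = {} \<and> r \<inter> B \<times> B = {}"
    using less.prems(2,6,7) by blast
  ultimately show ?case by (simp add: g fin)
qed

section \<open>Linear extensions as lists\<close>

text \<open>
  The order in which \<open>y\<close> is below \<open>x\<close> if \<open>x\<close> comes first in the list. Positions decrease
  along the order, in accordance with descending lists, in which arcs lead to earlier entries.
\<close>

primrec down_order :: "'a list \<Rightarrow> 'a rel" where
  "down_order [] = {}"
| "down_order (x # xs) = insert x (set xs) \<times> {x} \<union> down_order xs"

lemma down_order_subset: "down_order xs \<subseteq> set xs \<times> set xs"
  by (induction xs) auto

lemma linear_order_down_order: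
  assumes "distinct xs"
  shows "linear_order_on (set xs) (down_order xs)"
proof -
  have "refl_on (set xs) (down_order xs)"
    by (induction xs) (auto simp: refl_on_def)
  moreover have "trans (down_order xs)"
    using assms
  proof (induction xs)
    case (Cons x xs)
    then show ?case
      using down_order_subset[of xs] by (auto simp: trans_def)
  qed simp
  moreover have "antisym (down_order xs)"
    using assms
  proof (induction xs)
    case (Cons x xs)
    then show ?case
      using down_order_subset[of xs] by (auto simp: antisym_def)
  qed simp
  moreover have "total_on (set xs) (down_order xs)"
    by (induction xs) (auto simp: total_on_def)
  ultimately show ?thesis
    using down_order_subset[of xs] by (auto simp: order_on_defs)
qed

lemma sorted_wrt_down_order: "sorted_wrt (\<lambda>x y. (y, x) \<in> down_order xs) xs"
proof (induction xs)
  case (Cons x xs)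
  then show ?case by (auto elim!: sorted_wrt_mono_rel[rotated])
qed simp

lemma down_order_sorted_wrtD:
  assumes "sorted_wrt P xs" "(y, x) \<in> down_order xs" "x \<noteq> y"
  shows "P x y"
  using assms by (induction xs) auto

lemma sorted_wrt_antisym_unique:
  assumes "antisym R" "distinct xs" "distinct ys" "set xs = set ys"
    and "sorted_wrt (\<lambda>x y. (y, x) \<in> R) xs" "sorted_wrt (\<lambda>x y. (y, x) \<in> R) ys"
  shows "xs = ys"
  using assms(2-)
proof (induction xs arbitrary: ys)
  case (Cons x xs)
  then obtain y ys' where ys: "ys = y # ys'" by (cases ys) auto
  have "x = y"
  proof (rule ccontr)
    assume "x \<noteq> y"
    then have "y \<in> set xs" "x \<in> set ys'" using Cons.prems(3) unfolding ys by auto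
    then have "(y, x) \<in> R" "(x, y) \<in> R" using Cons.prems(4,5) unfolding ys by auto
    then show False using \<open>x \<noteq> y\<close> antisymD[OF assms(1)] by blast
  qed
  moreover from this have "set xs = set ys'"
    using Cons.prems(1-3) unfolding ys by (simp add: insert_ident)
  ultimately show ?case using Cons unfolding ys by simp
qed simp

lemma finite_linear_order_list:
  assumes "linear_order_on A L" "finite F" "F \<subseteq> A"
  shows "\<exists>xs. distinct xs \<and> set xs = F \<and> sorted_wrt (\<lambda>x y. (y, x) \<in> L) xs"
  using assms(2,3)
proof (induction F rule: finite_induct)
  case (insert a F)
  then obtain xs where xs: "distinct xs" "set xs = F" "sorted_wrt (\<lambda>x y. (y, x) \<in> L) xs"
    by auto
  have L: "trans L" "total_on A L" using assms(1) by (auto simp: order_on_defs)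
  have above: "(y, a) \<in> L" if "y \<in> F" "(a, y) \<notin> L" for y
    using L(2) insert.prems insert.hyps(2) that by (auto simp: total_on_def)
  \<comment> \<open>insert \<open>a\<close> after the elements that lie above it\<close>
  let ?ys = "filter (\<lambda>x. (a, x) \<in> L) xs @ a # filter (\<lambda>x. (a, x) \<notin> L) xs"
  have "sorted_wrt (\<lambda>x y. (y, x) \<in> L) ?ys"
    using xs(2,3) above by (auto simp: sorted_wrt_append sorted_wrt_filter intro: transD[OF L(1)])
  moreover have "distinct ?ys" "set ?ys = insert a F"
    using xs insert.hyps(2) by auto
  ultimately show ?case by blast
qed simp

lemma down_order_eqI:
  assumes "linear_order_on (set xs) L" "distinct xs" "sorted_wrt (\<lambda>x y. (y, x) \<in> L) xs"
  shows "down_order xs = L"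
proof -
  have L: "L \<subseteq> set xs \<times> set xs" "refl_on (set xs) L" "antisym L"
    using assms(1) by (auto simp: order_on_defs)
  have sub: "down_order xs \<subseteq> L"
  proof clarify
    fix y x assume yx: "(y, x) \<in> down_order xs"
    then have "x \<in> set xs" using down_order_subset by fastforce
    then show "(y, x) \<in> L"
      using down_order_sorted_wrtD[OF assms(3) yx] L(2) by (cases "x = y") (auto simp: refl_on_def)
  qed
  have D: "total_on (set xs) (down_order xs)" "refl_on (set xs) (down_order xs)"
    using linear_order_down_order[OF assms(2)] by (auto simp: order_on_defs)
  have "(u, v) \<in> down_order xs" if uv: "(u, v) \<in> L" for u v
  proof (cases "u = v")
    case True
    then show ?thesis using uv L(1) D(2) by (auto simp: refl_on_def)
  next
    case False
    then have "(v, u) \<notin> down_order xs" using uv sub antisymD[OF L(3)] by blast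
    then show ?thesis using D(1) False uv L(1) by (auto simp: total_on_def)
  qed
  then show ?thesis using sub by auto
qed

lemma (in loopfree_digraph) linear_extension_down_order:
  assumes "distinct xs" "set xs = verts G"
  shows "down_order xs \<in> linear_extensions G \<longleftrightarrow> sorted_wrt (\<lambda>x y. (x, y) \<notin> arcs_ends G) xs"
proof
  have lin: "linear_order_on (verts G) (down_order xs)"
    using linear_order_down_order[OF assms(1)] assms(2) by simp
  then have ord: "antisym (down_order xs)" "trans (down_order xs)" "total_on (verts G) (down_order xs)"
      "refl_on (verts G) (down_order xs)"
    by (auto simp: order_on_defs)
  {
    assume "down_order xs \<in> linear_extensions G"
    then have arcs: "arcs_ends G \<subseteq> down_order xs"
      by (auto simp: linear_extensions_def)
    have "sorted_wrt (\<lambda>x y. (y, x) \<in> down_order xs \<and> x \<noteq> y) xs"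
      using sorted_wrt_down_order[of xs] assms(1) by (auto simp: sorted_wrt_iff_nth_less nth_eq_iff_index_eq)
    then show "sorted_wrt (\<lambda>x y. (x, y) \<notin> arcs_ends G) xs"
      by (rule sorted_wrt_mono_rel[rotated]) (use arcs antisymD[OF ord(1)] in blast)
  next
    assume s: "sorted_wrt (\<lambda>x y. (x, y) \<notin> arcs_ends G) xs"
    have arcs: "(u, v) \<in> down_order xs" if uv: "u \<rightarrow> v" for u v
    proof (rule ccontr)
      assume "(u, v) \<notin> down_order xs"
      moreover have "u \<noteq> v" using adj_not_same uv by blast
      ultimately have "(v, u) \<in> down_order xs" "u \<noteq> v"
        using ord(3) adj_in_verts[OF uv] by (simp_all add: total_on_def) blast
      from down_order_sorted_wrtD[OF s this] uv show False by simp
    qed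
    have "(u, v) \<in> down_order xs" if "u \<rightarrow>\<^sup>* v" for u v
      using that
      by (induction rule: reachable_induct)
        (use ord(4) arcs transD[OF ord(2)] in \<open>auto simp: refl_on_def\<close>)
    then show "down_order xs \<in> linear_extensions G"
      using lin by (auto simp: linear_extensions_def)
  }
qed

lemma (in loopfree_digraph) card_linear_extensions:
  assumes "finite (verts G)"
  shows "card (linear_extensions G) =
    card {xs. distinct xs \<and> set xs = verts G \<and> sorted_wrt (\<lambda>x y. (x, y) \<notin> arcs_ends G) xs}"
proof -
  let ?X = "{xs. distinct xs \<and> set xs = verts G \<and> sorted_wrt (\<lambda>x y. (x, y) \<notin> arcs_ends G) xs}"
  have "bij_betw down_order ?X (linear_extensions G)"
  proof (intro bij_betwI')
    fix xs ys assume "xs \<in> ?X" "ys \<in> ?X"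
    then have xs: "distinct xs" "distinct ys" "set xs = set ys" by simp_all
    show "down_order xs = down_order ys \<longleftrightarrow> xs = ys"
    proof
      assume eq: "down_order xs = down_order ys"
      have "antisym (down_order xs)"
        using linear_order_down_order[OF xs(1)] by (simp add: order_on_defs)
      moreover have "sorted_wrt (\<lambda>x y. (y, x) \<in> down_order xs) ys"
        unfolding eq by (rule sorted_wrt_down_order)
      ultimately show "xs = ys"
        by (rule sorted_wrt_antisym_unique[OF _ xs sorted_wrt_down_order])
    qed simp
  next
    fix xs assume "xs \<in> ?X"
    then show "down_order xs \<in> linear_extensions G"
      using linear_extension_down_order by blast
  next
    fix L assume L: "L \<in> linear_extensions G"
    then have lin: "linear_order_on (verts G) L" by (simp add: linear_extensions_def)
    then obtain xs where xs: "distinct xs" "set xs = verts G" "sorted_wrt (\<lambda>x y. (y, x) \<in> L) xs"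
      using finite_linear_order_list[OF lin assms] by auto
    then have "L = down_order xs" using down_order_eqI[of xs L] lin by simp
    then show "\<exists>xs\<in>?X. L = down_order xs"
      using xs L linear_extension_down_order by blast
  qed
  then show ?thesis by (rule bij_betw_same_card[symmetric])
qed

lemma (in loopfree_digraph) not_acyclic_no_linear_extension:
  assumes "\<not> acyclic_quiver G"
  shows "linear_extensions G = {}"
proof (rule ccontr)
  assume "linear_extensions G \<noteq> {}"
  then obtain L where L: "linear_order_on (verts G) L" "\<And>u v. u \<rightarrow>\<^sup>* v \<Longrightarrow> (u, v) \<in> L"
    by (auto simp: linear_extensions_def)
  obtain p where "cycle p" using assms by (auto simp: acyclic_quiver_def)
  then obtain u where "u \<rightarrow>\<^sup>+ u" by (auto simp: cycle_def reachable1_awalk)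
  then obtain v where v: "u \<rightarrow> v" "v \<rightarrow>\<^sup>* u"
    by (meson reachable1_in_verts reachable_conv' tranclD adj_in_verts)
  then have "(u, v) \<in> L" "(v, u) \<in> L" using L(2) by auto
  then have "u = v" using L(1) by (auto simp: order_on_defs dest: antisymD)
  then show False using v adj_not_same by simp
qed

text \<open>
  No case distinction on acyclicity is needed: a loop-free quiver with a directed cycle has no
  linear extension, since reachability is not antisymmetric.
\<close>

lemma (in loopfree_digraph) e0_eq:
  assumes "finite (verts G)"
  shows "e0 G = of_nat (card {xs. distinct xs \<and> set xs = verts G \<and>
    sorted_wrt (\<lambda>x y. (x, y) \<notin> arcs_ends G) xs}) / fact (card (verts G))"
  unfolding card_linear_extensions[OF assms, symmetric]
  by (simp add: e0_def not_acyclic_no_linear_extension)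

section \<open>Connected components\<close>

context wf_digraph begin

text \<open>Undirected reachability; it implies that both vertices belong to the quiver.\<close>

abbreviation linked :: "'a \<Rightarrow> 'a \<Rightarrow> bool" where
  "linked u v \<equiv> u \<rightarrow>\<^sup>*\<^bsub>with_proj (mk_symmetric G)\<^esub> v"

lemma wf_digraph_mk_symmetric: "wf_digraph (with_proj (mk_symmetric G))"
  using wellformed_mk_symmetric by (simp add: wf_digraph_wp_iff)

lemma linked_sym: "linked u v \<Longrightarrow> linked v u"
  by (rule symmetric_reachable[OF symmetric_mk_symmetric])

lemma linked_trans: "linked u v \<Longrightarrow> linked v w \<Longrightarrow> linked u w"
  by (rule wf_digraph.reachable_trans[OF wf_digraph_mk_symmetric])

lemma linked_refl: "v \<in> verts G \<Longrightarrow> linked v v"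
  by (rule wf_digraph.reachable_refl[OF wf_digraph_mk_symmetric]) simp

lemma linked_arc: "a \<in> arcs G \<Longrightarrow> linked (tail G a) (head G a)"
  by (rule wf_digraph.reachable_adjI[OF wf_digraph_mk_symmetric]) (auto simp: parcs_mk_symmetric)

lemma linked_in_verts: "linked u v \<Longrightarrow> u \<in> verts G \<and> v \<in> verts G"
  by (auto elim: reachable_in_vertsE)

lemma linked_invariant:
  assumes "linked u v" "u \<in> B" "\<And>a. a \<in> arcs G \<Longrightarrow> tail G a \<in> B \<longleftrightarrow> head G a \<in> B"
  shows "v \<in> B"
  using assms(1)
proof (induction rule: wf_digraph.reachable_induct[OF wf_digraph_mk_symmetric, consumes 1])
  case (2 x y)
  then show ?case using assms(3) by (auto simp: parcs_mk_symmetric)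
qed (rule assms(2))

lemma component_of_eq: "component_of G v = {u. linked v u}"
  using linked_sym by (auto simp: component_of_def pre_digraph.scc_of_def)

lemma components_eq: "components G = component_of G ` verts G"
proof (intro set_eqI iffI)
  fix C assume "C \<in> components G"
  then have C: "C \<noteq> {}" "\<And>u v. u \<in> C \<Longrightarrow> v \<in> C \<Longrightarrow> linked u v"
      "\<And>u v. u \<in> C \<Longrightarrow> v \<notin> C \<Longrightarrow> \<not> linked u v \<or> \<not> linked v u"
    by (auto simp: components_def pre_digraph.sccs_verts_def)
  then obtain u where u: "u \<in> C" by auto
  then have "C = component_of G u"
    using C linked_sym by (auto simp: component_of_eq)
  then show "C \<in> component_of G ` verts G"
    using C(2)[OF u u] linked_in_verts by auto
next
  fix C assume "C \<in> component_of G ` verts G"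
  then obtain u where u: "u \<in> verts G" "C = component_of G u" by auto
  have "C \<noteq> {}" using u linked_refl by (auto simp: component_of_eq)
  moreover have "linked v w" if "v \<in> C" "w \<in> C" for v w
    using that linked_trans[OF linked_sym] unfolding u component_of_eq by blast
  moreover have "\<not> linked v w" if "v \<in> C" "w \<notin> C" for v w
    using that linked_trans unfolding u component_of_eq by blast
  ultimately show "C \<in> components G"
    unfolding components_def pre_digraph.sccs_verts_def by blast
qed

lemma component_of_self: "v \<in> verts G \<Longrightarrow> v \<in> component_of G v"
  by (simp add: component_of_eq linked_refl)

lemma component_of_linked:
  assumes "linked u v"
  shows "component_of G u = component_of G v"
  unfolding component_of_eq
  using linked_trans[OF assms] linked_trans[OF linked_sym[OF assms]] by blast

lemma component_of_unique: "C \<in> components G \<Longrightarrow> v \<in> C \<Longrightarrow> component_of G v = C"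
  unfolding components_eq using component_of_linked component_of_eq by blast

lemma component_of_arc: "a \<in> arcs G \<Longrightarrow> component_of G (tail G a) = component_of G (head G a)"
  by (rule component_of_linked[OF linked_arc])

lemma partition_on_components: "partition_on (verts G) (components G)"
proof (rule partition_onI)
  show "\<Union>(components G) = verts G"
    using component_of_self linked_in_verts by (auto simp: components_eq component_of_eq)
  show "disjnt p q" if "p \<in> components G" "q \<in> components G" "p \<noteq> q" for p q
    using that component_of_unique unfolding disjnt_iff by metis
  show "{} \<notin> components G"
    using component_of_self by (auto simp: components_eq)
qed

lemma component_subset_block:
  assumes "partition_on (verts G) \<pi>" "\<forall>a\<in>arcs G. \<exists>B\<in>\<pi>. tail G a \<in> B \<and> head G a \<in> B"
    and "B \<in> \<pi>" "v \<in> B"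
  shows "component_of G v \<subseteq> B"
proof
  fix u assume "u \<in> component_of G v"
  then have "linked v u" by (simp add: component_of_eq)
  then show "u \<in> B"
  proof (rule linked_invariant)
    fix a assume "a \<in> arcs G"
    then obtain C where "C \<in> \<pi>" "tail G a \<in> C" "head G a \<in> C" using assms(2) by auto
    then show "tail G a \<in> B \<longleftrightarrow> head G a \<in> B"
      using assms(1,3) unfolding partition_on_def disjoint_def by blast
  qed (rule assms(4))
qed

lemma connected_iff_components:
  assumes "verts G \<noteq> {}"
  shows "connected G \<longleftrightarrow> components G = {verts G}"
proof
  assume "connected G"
  then have *: "linked u v" if "u \<in> verts G" "v \<in> verts G" for u v
    using that by (simp add: connected_def strongly_connected_def)
  have "component_of G v = verts G" if "v \<in> verts G" for v
    unfolding component_of_eq using * that linked_in_verts by blast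
  then show "components G = {verts G}"
    using assms by (auto simp: components_eq)
next
  assume *: "components G = {verts G}"
  have "linked u v" if "u \<in> verts G" "v \<in> verts G" for u v
    using that component_of_unique[of "verts G" u] * unfolding component_of_eq by blast
  then show "connected G"
    using assms by (simp add: connected_def strongly_connected_def)
qed

end

section \<open>Signed sums over ordered set partitions\<close>

lemma const_0: "const 0 = 0" and const_1: "const 1 = 1"
  by (simp_all add: const_def)

lemma const_add: "const (a + b) = const a + const b"
  by (simp add: const_def single_add)

lemma const_mult: "const (a * b) = const a * const b"
  by (simp add: const_def mult_single)

lemma const_sum: "const (sum f A) = (\<Sum>x\<in>A. const (f x))"
  by (induction A rule: infinite_finite_induct) (simp_all add: const_0 const_add)

lemma const_prod: "const (prod f A) = (\<Prod>x\<in>A. const (f x))"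
  by (induction A rule: infinite_finite_induct) (simp_all add: const_1 const_mult)

lemma beta_plus_eq: "beta_plus a = 1 + (beta_minus a :: ('e, 'k::field_char_0) param_poly)"
proof -
  have "const (1 / 2) * 2 = (const 1 :: ('e, 'k) param_poly)"
    by (simp add: mult_2_right flip: const_add)
  moreover have "beta a + 1 = 2 + (beta a - 1 :: ('e, 'k) param_poly)"
    by simp
  ultimately show ?thesis
    by (simp only: beta_plus_def beta_minus_def distrib_left const_1)
qed

lemma block_index_eq:
  assumes "Bs \<in> OSP V" "i < length Bs" "v \<in> Bs ! i"
  shows "block_index Bs v = i"
  unfolding block_index_def
proof (rule the_equality)
  have s: "sorted_wrt (\<lambda>B C. B \<inter> C = {}) Bs" using assms(1) by (simp add: OSP_iff)
  fix j assume j: "j < length Bs \<and> v \<in> Bs ! j"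
  show "j = i"
    using sorted_wrt_nth_less[OF s, of i j] sorted_wrt_nth_less[OF s, of j i] j assms(2,3)
    by (cases i j rule: linorder_cases) auto
qed (use assms in auto)

lemma OSP_block_index:
  assumes "Bs \<in> OSP V" "v \<in> V"
  shows "block_index Bs v < length Bs" "v \<in> Bs ! block_index Bs v"
proof -
  obtain i where "i < length Bs" "v \<in> Bs ! i"
    using assms by (auto simp: OSP_iff in_set_conv_nth)
  then show "block_index Bs v < length Bs" "v \<in> Bs ! block_index Bs v"
    using block_index_eq[OF assms(1)] by auto
qed

lemma strictly_descending_iff:
  assumes "Bs \<in> OSP V"
  shows "strictly_descending r Bs \<longleftrightarrow> (\<forall>(u, v)\<in>r \<inter> V \<times> V. block_index Bs v < block_index Bs u)"
    (is "_ \<longleftrightarrow> ?R")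
proof
  assume "strictly_descending r Bs"
  then have s: "sorted_wrt (\<lambda>B C. r \<inter> B \<times> C = {}) Bs" "\<And>B. B \<in> set Bs \<Longrightarrow> r \<inter> B \<times> B = {}"
    by (auto simp: strictly_descending_def descending_def)
  show ?R
  proof clarify
    fix u v assume uv: "(u, v) \<in> r" "u \<in> V" "v \<in> V"
    note u = OSP_block_index[OF assms uv(2)] and v = OSP_block_index[OF assms uv(3)]
    show "block_index Bs v < block_index Bs u"
    proof (rule ccontr)
      assume "\<not> block_index Bs v < block_index Bs u"
      then consider "block_index Bs u < block_index Bs v" | "block_index Bs u = block_index Bs v"
        by linarith
      then show False
      proof cases
        case 1
        then show False using sorted_wrt_nth_less[OF s(1) 1 v(1)] u(2) v(2) uv(1) by blast
      next
        case 2
        then show False using s(2)[OF nth_mem[OF u(1)]] u(2) v(2) uv(1) by auto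
      qed
    qed
  qed
next
  assume R: ?R
  have V: "Bs ! i \<subseteq> V" if "i < length Bs" for i
    using assms that by (auto simp: OSP_iff)
  have *: "r \<inter> Bs ! i \<times> Bs ! j = {}" if "i \<le> j" "j < length Bs" for i j
  proof (rule ccontr)
    assume "r \<inter> Bs ! i \<times> Bs ! j \<noteq> {}"
    then obtain u v where uv: "(u, v) \<in> r" "u \<in> Bs ! i" "v \<in> Bs ! j" by auto
    then have "block_index Bs u = i" "block_index Bs v = j"
      using block_index_eq[OF assms] that by auto
    moreover have "u \<in> V" "v \<in> V" using V[of i] V[of j] uv that by auto
    ultimately show False using bspec[OF R, of "(u, v)"] uv(1) that by auto
  qed
  then show "strictly_descending r Bs"
    unfolding strictly_descending_def descending_def sorted_wrt_iff_nth_less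
    by (metis in_set_conv_nth order.refl less_imp_le)
qed

text \<open>The arcs in \<open>F\<close> with both ends in \<open>B\<close>.\<close>

definition inner_arcs :: "('v, 'e) pre_digraph \<Rightarrow> 'e set \<Rightarrow> 'v set \<Rightarrow> 'e set" where
  "inner_arcs G F B = {a \<in> F. tail G a \<in> B \<and> head G a \<in> B}"

text \<open>
  The signed sum over ordered set partitions for the subquiver with vertex set \<open>B\<close> and arcs
  \<open>inner_arcs G F B\<close>.
\<close>

definition osp_sum :: "('v, 'e) pre_digraph \<Rightarrow> 'e set \<Rightarrow> 'v set \<Rightarrow> ('e, 'k::field_char_0) param_poly" where
  "osp_sum G F B = (\<Sum>Bs\<in>OSP B. const ((-1) ^ (length Bs - 1) / of_nat (length Bs)) *
    (\<Prod>a\<in>inner_arcs G F B. beta_sign G Bs a))"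

lemma finite_inner_arcs: "finite F \<Longrightarrow> finite (inner_arcs G F B)"
  by (simp add: inner_arcs_def)

lemma beta_sign_eq:
  "beta_sign G Bs a = of_bool (block_index Bs (head G a) < block_index Bs (tail G a)) +
    (beta_minus a :: ('e, 'k::field_char_0) param_poly)"
  by (simp add: beta_sign_def beta_plus_eq)

lemma prod_of_bool: "finite A \<Longrightarrow> (\<Prod>a\<in>A. of_bool (P a)) = (of_bool (\<forall>a\<in>A. P a) :: 'a::comm_semiring_1)"
  by (induction A rule: finite_induct) auto

lemma prod_strict:
  assumes "Bs \<in> OSP B" "finite F"
  shows "(\<Prod>a\<in>inner_arcs G F B. of_bool (block_index Bs (head G a) < block_index Bs (tail G a))) =
    (of_bool (strictly_descending (arc_to_ends G ` F) Bs) :: ('e, 'k::field_char_0) param_poly)"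
  unfolding prod_of_bool[OF finite_inner_arcs[OF assms(2)]] strictly_descending_iff[OF assms(1)]
  by (rule arg_cong[where f = of_bool]) (auto simp: inner_arcs_def arc_to_ends_def)

lemma const_log_count:
  assumes "finite B"
  shows "(\<Sum>Bs\<in>OSP B. const ((-1) ^ (length Bs - 1) / of_nat (length Bs)) *
      of_bool (strictly_descending r Bs)) = (const (log_count r B) :: ('e, 'k::field_char_0) param_poly)"
  unfolding log_count_def const_sum
  by (rule sum.mono_neutral_cong_right) (auto simp: finite_OSP[OF assms])

text \<open>
  Since \<open>\<beta>\<^sub>+ = 1 + \<beta>\<^sub>-\<close>, the weight of an arc is \<open>\<beta>\<^sub>-\<close> plus the indicator of sign \<open>+\<close>; expanding
  the product over the arcs collects the arcs for which the indicator is chosen in \<open>S\<close>.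
\<close>

lemma osp_sum_expand:
  assumes "finite F" "finite B"
  shows "osp_sum G F B = (\<Sum>S\<in>Pow (inner_arcs G F B).
    const (log_count (arc_to_ends G ` S) B) * (\<Prod>a\<in>inner_arcs G F B - S. beta_minus a)
      :: ('e, 'k::field_char_0) param_poly)"
proof -
  let ?I = "inner_arcs G F B"
  let ?c = "\<lambda>Bs. const ((-1) ^ (length Bs - 1) / of_nat (length Bs)) :: ('e, 'k) param_poly"
  let ?b = "\<lambda>S Bs. of_bool (strictly_descending (arc_to_ends G ` S) Bs) :: ('e, 'k) param_poly"
  let ?m = "\<lambda>S. \<Prod>a\<in>?I - S. beta_minus a :: ('e, 'k) param_poly"
  have "osp_sum G F B = (\<Sum>Bs\<in>OSP B. ?c Bs * (\<Sum>S\<in>Pow ?I. ?b S Bs * ?m S))"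
    unfolding osp_sum_def
  proof (intro sum.cong refl arg_cong2[where f = "(*)"])
    fix Bs assume Bs: "Bs \<in> OSP B"
    have "(\<Prod>a\<in>S. of_bool (block_index Bs (head G a) < block_index Bs (tail G a))) = ?b S Bs"
      if "S \<in> Pow ?I" for S
    proof -
      have "inner_arcs G S B = S" "finite S"
        using that finite_subset[OF _ assms(1)] by (auto simp: inner_arcs_def)
      then show ?thesis using prod_strict[OF Bs, of S G, where 'k = 'k] by simp
    qed
    then show "(\<Prod>a\<in>?I. beta_sign G Bs a) = (\<Sum>S\<in>Pow ?I. ?b S Bs * ?m S)"
      by (simp add: beta_sign_eq prod_add[OF finite_inner_arcs[OF assms(1)]])
  qed
  also have "\<dots> = (\<Sum>S\<in>Pow ?I. (\<Sum>Bs\<in>OSP B. ?c Bs * ?b S Bs) * ?m S)"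
    unfolding sum_distrib_left sum_distrib_right
    by (subst sum.swap) (simp add: mult.assoc)
  finally show ?thesis by (simp only: const_log_count[OF assms(2)])
qed

lemma osp_sum_split:
  assumes "finite F" "finite B" "B = C \<union> D" "C \<inter> D = {}" "C \<noteq> {}" "D \<noteq> {}"
    and "\<And>a. a \<in> F \<Longrightarrow> tail G a \<in> C \<longleftrightarrow> head G a \<in> C"
  shows "osp_sum G F B = (0 :: ('e, 'k::field_char_0) param_poly)"
proof -
  have "log_count (arc_to_ends G ` S) B = (0 :: 'k)" if "S \<subseteq> inner_arcs G F B" for S
    by (rule log_count_split[OF assms(2-6)])
      (use assms(4,7) that in \<open>auto simp: inner_arcs_def arc_to_ends_def\<close>)
  then show ?thesis
    unfolding osp_sum_expand[OF assms(1,2)] by (simp add: const_0)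
qed

text \<open>
  Summing over \<open>F\<close> with weight \<open>-\<beta>\<^sub>-\<close> on the arcs outside \<open>F\<close> replaces every arc weight
  \<open>\<beta>\<^sub>s\<close> by \<open>\<beta>\<^sub>s - \<beta>\<^sub>-\<close>, the indicator of sign \<open>+\<close>. The parameters cancel.
\<close>

lemma osp_sum_convolution:
  assumes "finite E" "finite B"
  shows "(\<Sum>F\<in>Pow (inner_arcs G E B). osp_sum G F B * (\<Prod>a\<in>inner_arcs G E B - F. - beta_minus a)) =
    (const (log_count (arc_to_ends G ` E) B) :: ('e, 'k::field_char_0) param_poly)"
proof -
  let ?I = "inner_arcs G E B"
  let ?c = "\<lambda>Bs. const ((-1) ^ (length Bs - 1) / of_nat (length Bs)) :: ('e, 'k) param_poly"
  let ?m = "\<lambda>F. \<Prod>a\<in>?I - F. - beta_minus a :: ('e, 'k) param_poly"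
  have "osp_sum G F B = (\<Sum>Bs\<in>OSP B. ?c Bs * (\<Prod>a\<in>F. beta_sign G Bs a))" if "F \<in> Pow ?I" for F
  proof -
    have "inner_arcs G F B = F" using that by (auto simp: inner_arcs_def)
    then show ?thesis by (simp add: osp_sum_def)
  qed
  then have "(\<Sum>F\<in>Pow ?I. osp_sum G F B * ?m F) =
      (\<Sum>F\<in>Pow ?I. (\<Sum>Bs\<in>OSP B. ?c Bs * (\<Prod>a\<in>F. beta_sign G Bs a)) * ?m F)"
    by simp
  also have "\<dots> = (\<Sum>Bs\<in>OSP B. ?c Bs * (\<Sum>F\<in>Pow ?I. (\<Prod>a\<in>F. beta_sign G Bs a) * ?m F))"
    unfolding sum_distrib_left sum_distrib_right
    by (subst sum.swap) (simp add: mult.assoc)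
  also have "\<dots> = (\<Sum>Bs\<in>OSP B. ?c Bs * (\<Prod>a\<in>?I. beta_sign G Bs a + - beta_minus a))"
    by (simp only: prod_add[OF finite_inner_arcs[OF assms(1)]])
  also have "\<dots> = (\<Sum>Bs\<in>OSP B. ?c Bs * of_bool (strictly_descending (arc_to_ends G ` E) Bs))"
    by (rule sum.cong) (simp_all add: beta_sign_eq prod_strict[OF _ assms(1)])
  finally show ?thesis by (simp only: const_log_count[OF assms(2)])
qed

lemma sum_Pow_UN_prod:
  fixes f :: "'b \<Rightarrow> 'a set \<Rightarrow> 'c::comm_semiring_1"
  assumes "finite J" "\<And>j. j \<in> J \<Longrightarrow> finite (I j)" "\<And>i j. i \<in> J \<Longrightarrow> j \<in> J \<Longrightarrow> i \<noteq> j \<Longrightarrow> I i \<inter> I j = {}"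
  shows "(\<Sum>F\<in>Pow (\<Union>j\<in>J. I j). \<Prod>j\<in>J. f j (F \<inter> I j)) = (\<Prod>j\<in>J. \<Sum>F\<in>Pow (I j). f j F)"
  using assms
proof (induction J rule: finite_induct)
  case (insert j J)
  let ?U = "\<Union>i\<in>J. I i"
  have disj: "I j \<inter> ?U = {}" using insert.prems(2)[of j] insert.hyps(2) by fastforce
  have "(\<Sum>F\<in>Pow (\<Union>i\<in>insert j J. I i). \<Prod>i\<in>insert j J. f i (F \<inter> I i)) =
      (\<Sum>(X, Y)\<in>Pow (I j) \<times> Pow ?U. f j X * (\<Prod>i\<in>J. f i (Y \<inter> I i)))"
  proof (rule sum.reindex_bij_witness[where i = "\<lambda>(X, Y). X \<union> Y" and j = "\<lambda>F. (F \<inter> I j, F \<inter> ?U)"])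
    fix F assume F: "F \<in> Pow (\<Union>i\<in>insert j J. I i)"
    have "F \<inter> ?U \<inter> I i = F \<inter> I i" if "i \<in> J" for i using that by auto
    then have "(\<Prod>i\<in>J. f i (F \<inter> ?U \<inter> I i)) = (\<Prod>i\<in>J. f i (F \<inter> I i))"
      by simp
    then show "(case (F \<inter> I j, F \<inter> ?U) of (X, Y) \<Rightarrow> f j X * (\<Prod>i\<in>J. f i (Y \<inter> I i))) =
        (\<Prod>i\<in>insert j J. f i (F \<inter> I i))"
      using insert.hyps by simp
  qed (use disj in auto)
  also have "\<dots> = (\<Sum>X\<in>Pow (I j). f j X) * (\<Sum>Y\<in>Pow ?U. \<Prod>i\<in>J. f i (Y \<inter> I i))"
    by (simp add: sum.cartesian_product[symmetric] sum_product)
  finally show ?case using insert by simp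
qed simp

section \<open>The convolution inverse\<close>

text \<open>The arcs of \<open>G\<close> that lie inside a block of \<open>\<pi>\<close>.\<close>

definition block_arcs :: "('v, 'e) pre_digraph \<Rightarrow> 'v set set \<Rightarrow> 'e set" where
  "block_arcs G \<pi> = (\<Union>B\<in>\<pi>. inner_arcs G (arcs G) B)"

text \<open>
  The value of \<^const>\<open>e0\<close> at the quiver obtained by identifying each block of \<open>\<pi>\<close> to a vertex
  and deleting the tadpoles: the proportion of the orderings of \<open>\<pi>\<close> that are descending.
\<close>

definition order_ratio :: "('v \<times> 'v) set \<Rightarrow> 'v set set \<Rightarrow> 'k::field_char_0" where
  "order_ratio r \<pi> =
    of_nat (card {Bs. distinct Bs \<and> set Bs = \<pi> \<and> descending r Bs}) / fact (card \<pi>)"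

lemma sum_partitions_log_count:
  fixes V :: "'v set"
  assumes "finite V"
  shows "(\<Sum>\<pi> | partition_on V \<pi>. order_ratio r \<pi> * (\<Prod>B\<in>\<pi>. log_count r B)) =
    (if r \<inter> V \<times> V = {} then 1 else 0 :: 'k::field_char_0)"
proof -
  let ?D = "{Bs. Bs \<in> OSP V \<and> descending r Bs}"
  let ?g = "\<lambda>Bs. (\<Prod>B\<in>set Bs. log_count r B) / fact (length Bs) :: 'k"
  have "(\<Sum>Bs\<in>?D. ?g Bs) = (\<Sum>\<pi> | partition_on V \<pi>. \<Sum>Bs | Bs \<in> ?D \<and> set Bs = \<pi>. ?g Bs)"
    by (rule sum.group[symmetric])
      (simp add: finite_OSP[OF assms], simp add: finitely_many_partition_on[OF assms], auto simp: OSP_def)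
  also have "\<dots> = (\<Sum>\<pi> | partition_on V \<pi>. order_ratio r \<pi> * (\<Prod>B\<in>\<pi>. log_count r B))"
  proof (rule sum.cong[OF refl])
    fix \<pi> assume "\<pi> \<in> {\<pi>. partition_on V \<pi>}"
    then have "{Bs. Bs \<in> ?D \<and> set Bs = \<pi>} = {Bs. distinct Bs \<and> set Bs = \<pi> \<and> descending r Bs}"
      by (auto simp: OSP_def)
    then have "(\<Sum>Bs | Bs \<in> ?D \<and> set Bs = \<pi>. ?g Bs) =
        (\<Sum>Bs | distinct Bs \<and> set Bs = \<pi> \<and> descending r Bs. (\<Prod>B\<in>\<pi>. log_count r B) / fact (card \<pi>))"
      by (intro sum.cong) (auto simp: distinct_card)
    then show "(\<Sum>Bs | Bs \<in> ?D \<and> set Bs = \<pi>. ?g Bs) = order_ratio r \<pi> * (\<Prod>B\<in>\<pi>. log_count r B)"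
      by (simp add: order_ratio_def)
  qed
  finally show ?thesis
    by (simp only: sum_descending_log_count[OF assms])
qed

lemma (in wf_digraph) spanning_iff:
  "spanning H G \<longleftrightarrow> (\<exists>F\<subseteq>arcs G. H = G\<lparr>arcs := F\<rparr>)"
proof
  assume "spanning H G"
  then show "\<exists>F\<subseteq>arcs G. H = G\<lparr>arcs := F\<rparr>"
    by (intro exI[of _ "arcs H"])
      (auto simp: spanning_def subgraph_def compatible_def intro!: pre_digraph.equality)
next
  assume "\<exists>F\<subseteq>arcs G. H = G\<lparr>arcs := F\<rparr>"
  then show "spanning H G"
    by (auto simp: spanning_def subgraph_def compatible_def wf_digraph wf_digraph_def subset_iff)
qed

text \<open>
  The tadpoles of the contraction are the arcs inside a component that are missing from \<open>H\<close>.
  Arcs between different components are never in \<open>H\<close>, so the pruned contraction has exactly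
  the arcs of \<open>G\<close> between different components.
\<close>

lemma e_fun_contract:
  assumes "fin_digraph G" "spanning H G"
  shows "e_fun (contract G H) =
    (\<Prod>a\<in>block_arcs G (components H) - arcs H. - beta_minus a) *
      (const (order_ratio (arcs_ends G) (components H)) :: ('e, 'k::field_char_0) param_poly)"
proof -
  interpret G: fin_digraph G by fact
  interpret H: fin_digraph H by (rule spanning_fin_digraph[OF assms])
  have eq: "verts H = verts G" "tail H = tail G" "head H = head G" "arcs H \<subseteq> arcs G"
    using assms(2) by (auto simp: spanning_def subgraph_def compatible_def)
  have same: "component_of H u = component_of H v \<longleftrightarrow> (\<exists>B\<in>components H. u \<in> B \<and> v \<in> B)"
    if "u \<in> verts G" "v \<in> verts G" for u v
    using that H.component_of_self H.component_of_unique
    by (metis H.components_eq eq(1) imageI)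
  have comp: "component_of H u = B \<longleftrightarrow> u \<in> B" if "u \<in> verts G" "B \<in> components H" for u B
    using that H.component_of_self H.component_of_unique eq(1) by metis
  have tad: "tadpoles (contract G H) = block_arcs G (components H) - arcs H"
  proof -
    have "component_of H (tail G a) = component_of H (head G a) \<longleftrightarrow>
        (\<exists>B\<in>components H. tail G a \<in> B \<and> head G a \<in> B)" if "a \<in> arcs G" for a
      using that by (intro same) auto
    then show ?thesis
      unfolding tadpoles_def contract_def block_arcs_def inner_arcs_def by auto
  qed
  let ?P = "pruned (contract G H)"
  have ends: "arcs_ends ?P = {(component_of H (tail G a), component_of H (head G a)) | a.
      a \<in> arcs G \<and> component_of H (tail G a) \<noteq> component_of H (head G a)}"
    using H.component_of_arc eq(2,3)
    by (auto simp: arcs_ends_conv pruned_def tadpoles_def contract_def image_iff)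
  have fin: "finite (components H)"
    by (rule finite_components) (rule H.fin_digraph)
  have P: "loopfree_digraph ?P"
    by unfold_locales
      (auto simp: pruned_def tadpoles_def contract_def H.components_eq eq)
  have cross: "(B, C) \<in> arcs_ends ?P \<longleftrightarrow> arcs_ends G \<inter> B \<times> C \<noteq> {}"
    if "B \<in> components H" "C \<in> components H" "B \<noteq> C" for B C
  proof -
    have "(B, C) \<in> arcs_ends ?P \<longleftrightarrow>
        (\<exists>a\<in>arcs G. component_of H (tail G a) = B \<and> component_of H (head G a) = C)"
      using that(3) unfolding ends by blast
    also have "\<dots> \<longleftrightarrow> (\<exists>a\<in>arcs G. tail G a \<in> B \<and> head G a \<in> C)"
      using comp that by simp
    also have "\<dots> \<longleftrightarrow> arcs_ends G \<inter> B \<times> C \<noteq> {}"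
      by (auto simp: arcs_ends_conv)
    finally show ?thesis .
  qed
  have desc: "sorted_wrt (\<lambda>B C. (B, C) \<notin> arcs_ends ?P) Bs \<longleftrightarrow> descending (arcs_ends G) Bs"
    if "distinct Bs" "set Bs = components H" for Bs
  proof -
    have "(Bs ! i, Bs ! j) \<notin> arcs_ends ?P \<longleftrightarrow> arcs_ends G \<inter> Bs ! i \<times> Bs ! j = {}"
      if ij: "i < j" "j < length Bs" for i j
    proof -
      have "Bs ! i \<in> components H" "Bs ! j \<in> components H"
        using \<open>set Bs = components H\<close> ij nth_mem[of i Bs] nth_mem[of j Bs] by auto
      moreover have "Bs ! i \<noteq> Bs ! j"
        using \<open>distinct Bs\<close> ij by (simp add: nth_eq_iff_index_eq)
      ultimately show ?thesis using cross by blast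
    qed
    then show ?thesis
      unfolding descending_def sorted_wrt_iff_nth_less by simp
  qed
  have "verts ?P = components H" by (simp add: pruned_def contract_def)
  moreover from this have "{Bs. distinct Bs \<and> set Bs = verts ?P \<and> sorted_wrt (\<lambda>B C. (B, C) \<notin> arcs_ends ?P) Bs} =
      {Bs. distinct Bs \<and> set Bs = components H \<and> descending (arcs_ends G) Bs}"
    using desc by auto
  ultimately have "e0 ?P = (order_ratio (arcs_ends G) (components H) :: 'k)"
    using fin by (simp add: loopfree_digraph.e0_eq[OF P] order_ratio_def)
  then show ?thesis
    by (simp add: e_fun_def tad)
qed

text \<open>
  If all arcs of \<open>H\<close> stay inside the blocks of \<open>\<pi>\<close>, then each block is a union of components.
  Unless \<open>\<pi>\<close> is the set of components, some block splits off a component, and the sum for that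
  block vanishes.
\<close>

lemma osp_sum_refines:
  assumes "fin_digraph H" "partition_on (verts H) \<pi>" "arcs H \<subseteq> block_arcs H \<pi>" "\<pi> \<noteq> components H"
  shows "\<exists>B\<in>\<pi>. osp_sum H (arcs H) B = (0 :: ('e, 'k::field_char_0) param_poly)"
proof -
  interpret H: fin_digraph H by fact
  have arcs: "\<forall>a\<in>arcs H. \<exists>B\<in>\<pi>. tail H a \<in> B \<and> head H a \<in> B"
    using assms(3) by (auto simp: block_arcs_def inner_arcs_def)
  have verts: "B \<subseteq> verts H" if "B \<in> \<pi>" for B
    using assms(2) that by (auto simp: partition_on_def)
  have "\<not> (\<forall>B\<in>\<pi>. B \<in> components H)"
  proof
    assume sub: "\<forall>B\<in>\<pi>. B \<in> components H"
    have "C \<in> \<pi>" if C: "C \<in> components H" for C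
    proof -
      obtain v where v: "v \<in> verts H" "C = component_of H v"
        using C by (auto simp: H.components_eq)
      obtain B where "B \<in> \<pi>" "v \<in> B" using assms(2) v(1) by (auto simp: partition_on_def)
      then show ?thesis using sub H.component_of_unique v(2) by auto
    qed
    then show False using sub assms(4) by auto
  qed
  then obtain B where B: "B \<in> \<pi>" "B \<notin> components H" by auto
  obtain v where v: "v \<in> B" using partition_onD3[OF assms(2)] B(1) by (cases "B = {}") auto
  let ?C = "component_of H v"
  have C: "?C \<subseteq> B" by (rule H.component_subset_block[OF assms(2) arcs B(1) v])
  have vV: "v \<in> verts H" using v verts[OF B(1)] by auto
  have CH: "?C \<in> components H" using vV by (simp add: H.components_eq)
  have "osp_sum H (arcs H) B = (0 :: ('e, 'k) param_poly)"
  proof (rule osp_sum_split)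
    show "finite B" using verts[OF B(1)] H.finite_verts finite_subset by blast
    show "B = ?C \<union> (B - ?C)" "?C \<inter> (B - ?C) = {}" using C by auto
    show "?C \<noteq> {}" using H.component_of_self[OF vV] by auto
    show "B - ?C \<noteq> {}" using C B(2) CH by auto
    fix a assume a: "a \<in> arcs H"
    have "tail H a \<in> ?C \<longleftrightarrow> component_of H (tail H a) = ?C"
      using H.component_of_unique[OF CH] H.component_of_self[of "tail H a"] a by auto
    also have "\<dots> \<longleftrightarrow> component_of H (head H a) = ?C"
      using H.component_of_arc[OF a] by simp
    also have "\<dots> \<longleftrightarrow> head H a \<in> ?C"
      using H.component_of_unique[OF CH] H.component_of_self[of "head H a"] a by auto
    finally show "tail H a \<in> ?C \<longleftrightarrow> head H a \<in> ?C" .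
  qed simp
  then show ?thesis using B(1) by auto
qed

text \<open>
  The candidate for \<^const>\<open>omega\<close>: the product of the signed sums of the connected components,
  extended by \<open>0\<close> to everything that is not a finite quiver.
\<close>

definition component_product :: "('v, 'e) pre_digraph \<Rightarrow> ('e, 'k::field_char_0) param_poly" where
  "component_product H = (if fin_digraph H then \<Prod>B\<in>components H. osp_sum H (arcs H) B else 0)"

lemma osp_sum_arcs_update: "osp_sum (G\<lparr>arcs := F\<rparr>) = osp_sum G"
  by (simp add: osp_sum_def[abs_def] inner_arcs_def[abs_def] beta_sign_def[abs_def])

lemma block_arcs_sum:
  assumes "fin_digraph G" "partition_on (verts G) \<pi>"
  shows "(\<Sum>F\<in>Pow (block_arcs G \<pi>).
      (\<Prod>B\<in>\<pi>. osp_sum G F B) * (\<Prod>a\<in>block_arcs G \<pi> - F. - beta_minus a)) =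
    (const (\<Prod>B\<in>\<pi>. log_count (arcs_ends G) B) :: ('e, 'k::field_char_0) param_poly)"
proof -
  interpret G: fin_digraph G by fact
  let ?I = "inner_arcs G (arcs G)"
  have fin: "finite \<pi>" by (rule finite_elements[OF G.finite_verts assms(2)])
  have finB: "finite B" if "B \<in> \<pi>" for B
    using that assms(2) G.finite_verts by (metis partition_onD1 Union_upper finite_subset)
  have disj: "?I B \<inter> ?I C = {}" if "B \<in> \<pi>" "C \<in> \<pi>" "B \<noteq> C" for B C
    using that assms(2) unfolding partition_on_def disjoint_def inner_arcs_def by blast
  let ?f = "\<lambda>B F. osp_sum G F B * (\<Prod>a\<in>?I B - F. - beta_minus a) :: ('e, 'k) param_poly"
  have "(\<Prod>B\<in>\<pi>. osp_sum G F B) * (\<Prod>a\<in>block_arcs G \<pi> - F. - beta_minus a) = (\<Prod>B\<in>\<pi>. ?f B (F \<inter> ?I B))"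
    if "F \<in> Pow (block_arcs G \<pi>)" for F
  proof -
    have "F \<subseteq> arcs G" using that by (auto simp: block_arcs_def inner_arcs_def)
    then have "inner_arcs G (F \<inter> ?I B) B = inner_arcs G F B" for B
      by (auto simp: inner_arcs_def)
    then have "osp_sum G (F \<inter> ?I B) B = (osp_sum G F B :: ('e, 'k) param_poly)" for B
      by (simp add: osp_sum_def)
    moreover have "block_arcs G \<pi> - F = (\<Union>B\<in>\<pi>. ?I B - F \<inter> ?I B)"
      by (auto simp: block_arcs_def)
    moreover have "(\<Prod>a\<in>(\<Union>B\<in>\<pi>. ?I B - F \<inter> ?I B). - beta_minus a) =
        (\<Prod>B\<in>\<pi>. \<Prod>a\<in>?I B - F \<inter> ?I B. - beta_minus a :: ('e, 'k) param_poly)"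
      by (rule prod.UNION_disjoint) (use fin disj in \<open>auto simp: finite_inner_arcs\<close>)
    ultimately show ?thesis by (simp add: prod.distrib)
  qed
  then have "(\<Sum>F\<in>Pow (block_arcs G \<pi>).
      (\<Prod>B\<in>\<pi>. osp_sum G F B) * (\<Prod>a\<in>block_arcs G \<pi> - F. - beta_minus a)) =
      (\<Sum>F\<in>Pow (\<Union>B\<in>\<pi>. ?I B). \<Prod>B\<in>\<pi>. ?f B (F \<inter> ?I B))"
    by (simp add: block_arcs_def)
  also have "\<dots> = (\<Prod>B\<in>\<pi>. \<Sum>F\<in>Pow (?I B). ?f B F)"
    by (rule sum_Pow_UN_prod) (use fin disj in \<open>simp_all add: finite_inner_arcs\<close>)
  also have "\<dots> = (\<Prod>B\<in>\<pi>. const (log_count (arcs_ends G) B))"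
    using osp_sum_convolution[OF G.finite_arcs finB, where G = G]
    by (intro prod.cong) (simp_all add: arcs_ends_def)
  finally show ?thesis by (simp add: const_prod)
qed

text \<open>
  The term of a cut-subquiver with arc set \<open>F\<close> depends only on \<open>F\<close> and on the partition
  \<open>\<pi>\<close> of the vertices into its components. It may be replaced by the sum over all partitions
  \<open>\<pi>\<close> whose blocks contain the arcs of \<open>F\<close>, as the additional terms vanish. After exchanging
  the sums, \<open>F\<close> ranges over all subsets of the arcs inside blocks of \<open>\<pi>\<close>.
\<close>

lemma component_product_convolution:
  fixes G :: "('v, 'e) pre_digraph"
  assumes "fin_digraph G"
  shows "(\<Sum>H | spanning H G. component_product H * e_fun (contract G H)) =
    (counit G :: ('e, 'k::field_char_0) param_poly)"
proof -
  interpret G: fin_digraph G by fact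
  let ?H = "\<lambda>F. G\<lparr>arcs := F\<rparr>"
  let ?r = "arcs_ends G"
  let ?P = "{\<pi>. partition_on (verts G) \<pi>}"
  define T :: "'e set \<Rightarrow> 'v set set \<Rightarrow> ('e, 'k) param_poly" where
    "T F \<pi> = (\<Prod>B\<in>\<pi>. osp_sum G F B) * (\<Prod>a\<in>block_arcs G \<pi> - F. - beta_minus a) *
      const (order_ratio ?r \<pi>)" for F \<pi>
  have finP: "finite ?P" by (simp add: finitely_many_partition_on)
  have "{H. spanning H G} = ?H ` Pow (arcs G)"
    using G.spanning_iff by auto
  moreover have "inj_on ?H (Pow (arcs G))"
    by (rule inj_onI) (metis pre_digraph.select_convs(2) pre_digraph.surjective pre_digraph.update_convs(2))
  ultimately have "(\<Sum>H | spanning H G. component_product H * e_fun (contract G H)) =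
      (\<Sum>F\<in>Pow (arcs G). component_product (?H F) * e_fun (contract G (?H F)) :: ('e, 'k) param_poly)"
    by (simp add: sum.reindex)
  also have "\<dots> = (\<Sum>F\<in>Pow (arcs G). \<Sum>\<pi> | \<pi> \<in> ?P \<and> F \<subseteq> block_arcs G \<pi>. T F \<pi>)"
  proof (rule sum.cong[OF refl])
    fix F assume "F \<in> Pow (arcs G)"
    then have sp: "spanning (?H F) G" using G.spanning_iff by auto
    interpret H: fin_digraph "?H F" by (rule spanning_fin_digraph[OF assms sp])
    have inn: "block_arcs (?H F) \<pi> = block_arcs G \<pi> \<inter> F" for \<pi>
      using \<open>F \<in> Pow (arcs G)\<close> by (auto simp: block_arcs_def inner_arcs_def)
    let ?c = "components (?H F)"
    have "component_product (?H F) * e_fun (contract G (?H F)) = (\<Sum>\<pi>\<in>{?c}. T F \<pi>)"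
      by (simp add: component_product_def H.fin_digraph e_fun_contract[OF assms sp] T_def
          osp_sum_arcs_update mult.assoc)
    also have "\<dots> = (\<Sum>\<pi> | \<pi> \<in> ?P \<and> F \<subseteq> block_arcs G \<pi>. T F \<pi>)"
    proof (rule sum.mono_neutral_left)
      show "finite {\<pi>. \<pi> \<in> ?P \<and> F \<subseteq> block_arcs G \<pi>}" using finP by simp
      have "F \<subseteq> block_arcs G ?c"
      proof
        fix a assume a: "a \<in> F"
        let ?B = "component_of (?H F) (tail G a)"
        have v: "tail G a \<in> verts G" "head G a \<in> verts G"
          using a \<open>F \<in> Pow (arcs G)\<close> by auto
        have "tail G a \<in> ?B" "head G a \<in> ?B" "?B \<in> ?c"
          using H.component_of_arc[of a] H.component_of_self a v by (auto simp: H.components_eq)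
        then show "a \<in> block_arcs G ?c"
          using a \<open>F \<in> Pow (arcs G)\<close> by (auto simp: block_arcs_def inner_arcs_def)
      qed
      then show "{?c} \<subseteq> {\<pi>. \<pi> \<in> ?P \<and> F \<subseteq> block_arcs G \<pi>}"
        using H.partition_on_components by simp
      show "\<forall>\<pi>\<in>{\<pi>. \<pi> \<in> ?P \<and> F \<subseteq> block_arcs G \<pi>} - {?c}. T F \<pi> = 0"
      proof
        fix \<pi> assume \<pi>: "\<pi> \<in> {\<pi>. \<pi> \<in> ?P \<and> F \<subseteq> block_arcs G \<pi>} - {?c}"
        then have "finite \<pi>" by (auto intro: finite_elements[OF G.finite_verts])
        have "\<exists>B\<in>\<pi>. osp_sum (?H F) (arcs (?H F)) B = (0 :: ('e, 'k) param_poly)"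
          by (rule osp_sum_refines[OF H.fin_digraph]) (use \<pi> inn in auto)
        then have "(\<Prod>B\<in>\<pi>. osp_sum G F B) = (0 :: ('e, 'k) param_poly)"
          using \<open>finite \<pi>\<close> by (intro prod_zero) (auto simp: osp_sum_arcs_update)
        then show "T F \<pi> = 0" by (simp add: T_def)
      qed
    qed
    finally show "component_product (?H F) * e_fun (contract G (?H F)) =
        (\<Sum>\<pi> | \<pi> \<in> ?P \<and> F \<subseteq> block_arcs G \<pi>. T F \<pi>)" .
  qed
  also have "\<dots> = (\<Sum>\<pi>\<in>?P. \<Sum>F | F \<in> Pow (arcs G) \<and> F \<subseteq> block_arcs G \<pi>. T F \<pi>)"
    by (rule sum.swap_restrict) (simp_all add: finP)
  also have "\<dots> = (\<Sum>\<pi>\<in>?P. const (order_ratio ?r \<pi> * (\<Prod>B\<in>\<pi>. log_count ?r B)))"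
  proof (rule sum.cong[OF refl])
    fix \<pi> assume "\<pi> \<in> ?P"
    then have \<pi>: "partition_on (verts G) \<pi>" by simp
    have "{F. F \<in> Pow (arcs G) \<and> F \<subseteq> block_arcs G \<pi>} = Pow (block_arcs G \<pi>)"
      by (auto simp: block_arcs_def inner_arcs_def)
    then have "(\<Sum>F | F \<in> Pow (arcs G) \<and> F \<subseteq> block_arcs G \<pi>. T F \<pi>) =
        const (\<Prod>B\<in>\<pi>. log_count ?r B) * const (order_ratio ?r \<pi>)"
      by (simp add: T_def sum_distrib_right[symmetric] block_arcs_sum[OF assms \<pi>])
    then show "(\<Sum>F | F \<in> Pow (arcs G) \<and> F \<subseteq> block_arcs G \<pi>. T F \<pi>) =
        const (order_ratio ?r \<pi> * (\<Prod>B\<in>\<pi>. log_count ?r B))"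
      by (simp add: const_mult mult.commute)
  qed
  also have "\<dots> = const (if ?r \<inter> verts G \<times> verts G = {} then 1 else 0)"
    by (simp only: const_sum[symmetric] sum_partitions_log_count[OF G.finite_verts])
  also have "?r \<inter> verts G \<times> verts G = {} \<longleftrightarrow> arcs G = {}"
    by (auto simp: arcs_ends_conv)
  finally show ?thesis by (simp add: counit_def const_0 const_1)
qed

section \<open>The connected part of the inverse\<close>

lemma omega_eq_component_product: "omega = component_product"
  by (rule convolution_inverse_unique[OF is_convolution_inverse_omega])
    (simp add: is_convolution_inverse_e_def component_product_convolution, simp add: component_product_def)

theorem theorem6p5:
  fixes G :: "('v, 'e) pre_digraph"
  assumes "fin_digraph G" and "card (verts G) \<ge> 1"
  shows "(omega_c G :: ('e, 'k::field_char_0) param_poly) =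
    (\<Sum>Bs\<in>OSP (verts G).
      const ((-1) ^ (length Bs - 1) / of_nat (length Bs)) * (\<Prod>a\<in>arcs G. beta_sign G Bs a))"
proof -
  interpret G: fin_digraph G by fact
  have ne: "verts G \<noteq> {}" using assms(2) by auto
  have inn: "inner_arcs G (arcs G) (verts G) = arcs G" by (auto simp: inner_arcs_def)
  have "omega_c G = (osp_sum G (arcs G) (verts G) :: ('e, 'k) param_poly)"
  proof (cases "connected G")
    case True
    then have "components G = {verts G}" using G.connected_iff_components[OF ne] by simp
    then show ?thesis
      using True by (simp add: omega_c_def omega_eq_component_product component_product_def assms(1))
  next
    case False
    then have "{verts G} \<noteq> components G" using G.connected_iff_components[OF ne] by metis
    then have "osp_sum G (arcs G) (verts G) = (0 :: ('e, 'k) param_poly)"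
      using osp_sum_refines[OF assms(1) partition_on_space[OF ne], where 'k = 'k]
      by (simp add: block_arcs_def inn)
    then show ?thesis using False by (simp add: omega_c_def)
  qed
  then show ?thesis by (simp add: osp_sum_def inn)
qed

end
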